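(* Let $d \geq 3$. Let $B= \operatorname{conv}(S \cup (-S))$ for some ($d$-dimensional) simplex $S\subset\mathbb{R}^d$ centered at the origin $o$. Then $M^{HT}(d+1,d)= \mu_{d+1}^{HT}(B)$.
   Context: $\lambda_d$ denotes $d$-dimensional Lebesgue measure on $\mathbb{R}^d$, $\kappa_d$ is the volume of the Euclidean unit ball of $\mathbb{R}^d$, $o$ is the origin, and $\operatorname{conv}$ denotes convex hull. $\mathcal{K}^d_o$ is the family of $o$-symmetric convex bodies (compact convex sets with nonempty interior) in $\mathbb{R}^d$. $B^\circ$ denotes the polar of $B$. A simplex is centered at $o$ if its centroid is $o$. For $B\in\mathcal{K}^d_o$, the Holmes-Thompson volume of a set $S\subset\mathbb{R}^d$ in the normed space with unit ball $B$ is $\operatorname{vol}^{HT}_B(S)=\frac{\lambda_d(B^\circ)}{\kappa_d}\lambda_d(S)$. For $n\ge d+1$, $$\mu_n^{HT}(B)=\sup\{\operatorname{vol}_B^{HT}(Q): Q \text{ is a convex polytope contained in } B \text{ with at most } n \text{ vertices}\},$$ and $M^{HT}(n,d)=\sup\{\mu_n^{HT}(B): B\in\mathcal{K}^d_o\}$. *)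

theory Defs
  imports "HOL-Analysis.Analysis"
begin

definition convex_body :: "'a::euclidean_space set \<Rightarrow> bool" where
  "convex_body B \<longleftrightarrow> compact B \<and> convex B \<and> interior B \<noteq> {}"

definition o_symmetric :: "'a::real_vector set \<Rightarrow> bool" where
  "o_symmetric B \<longleftrightarrow> uminus ` B = B"

definition polar :: "'a::real_inner set \<Rightarrow> 'a set" where
  "polar B = {y. \<forall>x\<in>B. x \<bullet> y \<le> 1}"

definition centroid :: "'a::euclidean_space set \<Rightarrow> 'a" where
  "centroid S = (1 / measure lebesgue S) *\<^sub>R integral S (\<lambda>x. x)"

text \<open>Volumes and their suprema take values in \<^typ>\<open>ennreal\<close>, a complete lattice,
  so that every supremum below is the true one, with no boundedness side condition.\<close>

definition vol_HT :: "'a::euclidean_space set \<Rightarrow> 'a set \<Rightarrow> ennreal" where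
  "vol_HT B S = emeasure lebesgue (polar B) / emeasure lebesgue (cball (0::'a) 1) * emeasure lebesgue S"

definition mu_HT :: "nat \<Rightarrow> 'a::euclidean_space set \<Rightarrow> ennreal" where
  "mu_HT n B = (SUP Q \<in> {Q. polytope Q \<and> Q \<subseteq> B \<and> card {v. v extreme_point_of Q} \<le> n}. vol_HT B Q)"

text \<open>The dimension \<open>d\<close> is given by the index type: \<open>d = CARD('d)\<close>.\<close>

definition M_HT :: "nat \<Rightarrow> 'd::finite itself \<Rightarrow> ennreal" where
  "M_HT n _ = (SUP B \<in> {B :: (real^'d) set. convex_body B \<and> o_symmetric B}. mu_HT n B)"

end

theory Submission
  imports Defs
begin

text \<open>
  If a polytope \<open>Q \<subseteq> B\<close> with vertex set \<open>E\<close> has positive volume and at most \<open>d + 1\<close> vertices, it is a simplex, and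
  \<open>polar B\<close> is contained in \<open>{y. \<forall>v\<in>E. \<bar>v \<bullet> y\<bar> \<le> 1}\<close>, with equality when \<open>B = conv (Q \<union> - Q)\<close>. So one has to
  maximise the product of the volumes of this set and of \<open>Q\<close>. In terms of the barycentric coordinates
  \<open>a\<close> of the origin with respect to \<open>E\<close>, the product is, up to a constant, the density at \<open>0\<close> of \<open>\<Sum>v\<in>E. a v * U v\<close>,
  where the \<open>U v\<close> are independent and uniform on \<open>[-1, 1]\<close>. The density of \<open>p U + q U'\<close> is a trapezoid, which
  becomes more peaked when \<open>p\<close> and \<open>q\<close> are moved towards each other with \<open>p + q\<close> fixed, and
  peakedness is preserved by convolution with symmetric uniform laws. Hence moving two coordinates
  towards each other does not decrease the density, and after finitely many such moves all coordinates
  are equal, that is, the simplex is centred at the origin.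
\<close>

section \<open>Peakedness and smoothing by uniform laws\<close>

text \<open>For \<open>c > 0\<close> this is twice the convolution of \<open>g\<close> with the
  uniform density on [-c, c]. Integrating over the fixed interval [-1, 1] gives \<open>c = 0\<close>
  and negative \<open>c\<close> a meaning as well.\<close>

definition smear :: "real \<Rightarrow> (real \<Rightarrow> real) \<Rightarrow> real \<Rightarrow> real" where
  "smear c g x = integral {-1..1} (\<lambda>u. g (x + c * u))"

definition locally_integrable :: "(real \<Rightarrow> real) \<Rightarrow> bool" where
  "locally_integrable g \<longleftrightarrow> (\<forall>a b. g integrable_on {a..b})"

lemma smear_has_integral:
  assumes "locally_integrable g"
  shows "((\<lambda>u. g (x + c * u)) has_integral smear c g x) {-1..1}"
proof (cases "c = 0")
  case True
  then show ?thesis using has_integral_const_real[of "g x" "-1" 1] by (simp add: smear_def)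
next
  case False
  have "(\<lambda>u. g (c * u + x)) integrable_on ((\<lambda>u. (1 / c) *\<^sub>R u + - ((1 / c) *\<^sub>R x)) ` cbox (x - \<bar>c\<bar>) (x + \<bar>c\<bar>))"
    using assms has_integral_affinity[of g _ "x - \<bar>c\<bar>" "x + \<bar>c\<bar>" c x] False
    unfolding locally_integrable_def integrable_on_def by fastforce
  also have "((\<lambda>u. (1 / c) *\<^sub>R u + - ((1 / c) *\<^sub>R x)) ` cbox (x - \<bar>c\<bar>) (x + \<bar>c\<bar>)) = {-1..1}"
  proof -
    have "u \<in> (\<lambda>u. (1 / c) *\<^sub>R u + - ((1 / c) *\<^sub>R x)) ` cbox (x - \<bar>c\<bar>) (x + \<bar>c\<bar>)" if "u \<in> {-1..1}" for u
    proof (rule image_eqI[where x = "c * u + x"])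
      have "\<bar>c * u\<bar> \<le> \<bar>c\<bar>"
        using that by (simp add: abs_mult abs_le_iff mult_left_le)
      then show "c * u + x \<in> cbox (x - \<bar>c\<bar>) (x + \<bar>c\<bar>)" by auto
    qed (use False in \<open>simp add: field_simps\<close>)
    moreover have "(1 / c) * v - ((1 / c) * x) \<in> {-1..1}" if "\<bar>v - x\<bar> \<le> \<bar>c\<bar>" for v
    proof -
      have "\<bar>(v - x) / c\<bar> \<le> 1"
        using that False by (simp add: abs_divide)
      then show ?thesis by (simp add: diff_divide_distrib abs_le_iff)
    qed
    ultimately show ?thesis by force
  qed
  finally show ?thesis
    by (simp add: smear_def integrable_integral add.commute)
qed

lemma smear_uminus: "smear (- c) g x = smear c g x"
  unfolding smear_def using Henstock_Kurzweil_Integration.integral_reflect_real[of 1 "-1" "\<lambda>u. g (x + c * u)"] by simp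

lemma smear_zero [simp]: "smear 0 g = (\<lambda>x. 2 * g x)"
  by (simp add: smear_def fun_eq_iff)

lemma smear_pos:
  assumes "locally_integrable g" "c > 0"
  shows "smear c g x = integral {x - c..x + c} g / c"
proof -
  have "(g has_integral integral {x - c..x + c} g) (cbox (x - c) (x + c))"
    using assms by (simp add: locally_integrable_def integrable_integral)
  from has_integral_affinity'[OF this assms(2), of x] assms(2)
  show ?thesis
    unfolding smear_def by (intro integral_unique) (simp add: add.commute divide_inverse mult.commute)
qed

text \<open>A continuous primitive G turns \<open>smear c g x\<close> into (G (x + c) - G (x - c)) /
  c for \<open>c > 0\<close>, so that smoothing can be studied through differences of G.\<close>

lemma locally_integrable_primitive:
  assumes "locally_integrable g"
  obtains G where "continuous_on UNIV G" "\<And>a b. a \<le> b \<Longrightarrow> integral {a..b} g = G b - G a" "G 0 = 0"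
proof
  define G where "G = (\<lambda>x. if 0 \<le> x then integral {0..x} g else - integral {x..0} g)"
  have int: "g integrable_on {a..b}" for a b
    using assms by (simp add: locally_integrable_def)
  show eq: "integral {a..b} g = G b - G a" if "a \<le> b" for a b
    using that Henstock_Kurzweil_Integration.integral_combine[of a 0 b g, OF _ _ int] Henstock_Kurzweil_Integration.integral_combine[of a b 0 g, OF _ _ int]
      Henstock_Kurzweil_Integration.integral_combine[of 0 a b g, OF _ _ int] by (auto simp: G_def)
  show "G 0 = 0" by (simp add: G_def)
  have "isCont G x" for x
  proof -
    have "continuous_on {x - 1..x + 1} (\<lambda>y. integral {x - 1..y} g + G (x - 1))"
      by (intro continuous_intros indefinite_integral_continuous_1 int)
    then have "continuous_on {x - 1..x + 1} G"
      by (rule continuous_on_eq) (auto simp: eq)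
    then show ?thesis
      using continuous_on_interior[of "{x - 1..x + 1}" G x] by simp
  qed
  then show "continuous_on UNIV G"
    by (simp add: continuous_on_eq_continuous_at)
qed

lemma continuous_smear:
  assumes "locally_integrable g" "c > 0"
  shows "continuous_on UNIV (smear c g)"
proof -
  obtain G where G: "continuous_on UNIV G" "\<And>a b. a \<le> b \<Longrightarrow> integral {a..b} g = G b - G a"
    using locally_integrable_primitive[OF assms(1)] by metis
  have "smear c g = (\<lambda>x. (G (x + c) - G (x - c)) / c)"
    using assms by (auto simp: smear_pos G)
  then show ?thesis
    using assms(2) by (auto intro!: continuous_intros continuous_on_compose2[OF G(1)])
qed

lemma locally_integrable_smear:
  assumes "locally_integrable g" "c \<ge> 0"
  shows "locally_integrable (smear c g)"
proof (cases "c = 0")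
  case True
  then show ?thesis using assms by (simp add: locally_integrable_def integrable_on_cmult_left)
next
  case False
  then show ?thesis
    using continuous_smear[OF assms(1), of c] assms(2) unfolding locally_integrable_def
    by (auto intro!: integrable_continuous_real intro: continuous_on_subset)
qed

lemma smear_nonneg:
  assumes "\<And>x. g x \<ge> 0"
  shows "smear c g x \<ge> 0"
proof (cases "(\<lambda>u. g (x + c * u)) integrable_on {-1..1}")
  case True
  then show ?thesis unfolding smear_def using assms by (intro integral_nonneg) auto
next
  case False
  then show ?thesis by (simp add: smear_def not_integrable_integral)
qed

lemma smear_diff:
  assumes "locally_integrable g" "locally_integrable h"
  shows "smear c (\<lambda>x. g x - h x) x = smear c g x - smear c h x"
  using has_integral_diff[OF smear_has_integral[OF assms(1), of x c] smear_has_integral[OF assms(2), of x c]]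
  by (simp add: smear_def integral_unique)

text \<open>For the densities of two symmetric random variables, \<open>centrally_heavy\<close> of their difference
  says that the first variable is more peaked than the second one.\<close>

definition centrally_heavy :: "(real \<Rightarrow> real) \<Rightarrow> bool" where
  "centrally_heavy D \<longleftrightarrow> locally_integrable D \<and> (\<forall>x. D (- x) = D x) \<and> D 0 \<ge> 0 \<and>
     (\<forall>r\<ge>0. integral {0..r} D \<ge> 0)"

text \<open>A primitive G of \<open>D\<close> with G 0 = 0 is odd and nonnegative on the positive
  axis, so a primitive H of G is even and nondecreasing there. The integral of the smear over [0, r]
  is (H (r + c) - H |r - c|) / c, which is nonnegative because |r - c| <= r + c.\<close>

lemma centrally_heavy_smear:
  assumes "centrally_heavy D" "c \<ge> 0"
  shows "centrally_heavy (smear c D)"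
proof (cases "c = 0")
  case True
  then show ?thesis using assms locally_integrable_smear[of D 0] unfolding centrally_heavy_def by auto
next
  case False
  then have c: "c > 0" using assms by simp
  have D: "locally_integrable D" and even: "\<And>x. D (- x) = D x"
    and pos: "\<And>r. r \<ge> 0 \<Longrightarrow> integral {0..r} D \<ge> 0"
    using assms by (auto simp: centrally_heavy_def)
  obtain G where G: "continuous_on UNIV G" "\<And>a b. a \<le> b \<Longrightarrow> integral {a..b} D = G b - G a" "G 0 = 0"
    using locally_integrable_primitive[OF D] by metis
  have Gpos: "G x \<ge> 0" if "x \<ge> 0" for x
    using pos[OF that] G(2)[OF that] G(3) by simp
  have odd1: "G (- x) = - G x" if "x \<ge> 0" for x
  proof -
    have "integral {-x..-0} (\<lambda>u. D (- u)) = integral {0..x} D"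
      by (rule Henstock_Kurzweil_Integration.integral_reflect_real)
    then show ?thesis using G(2)[of 0 x] G(2)[of "-x" 0] that G(3) even by simp
  qed
  have odd: "G (- x) = - G x" for x
    using odd1[of x] odd1[of "-x"] by (cases "x \<ge> 0") auto
  have smearG: "smear c D x = (G (x + c) - G (x - c)) / c" for x
    using smear_pos[OF D c] G(2)[of "x - c" "x + c"] c by simp
  have "smear c D (- x) = smear c D x" for x
  proof -
    have "- x + c = - (x - c)" "- x - c = - (x + c)" by auto
    then show ?thesis unfolding smearG using odd by (simp only:) simp
  qed
  moreover have "smear c D 0 \<ge> 0"
    using smearG[of 0] odd[of c] Gpos[of c] c by simp
  moreover have "integral {0..r} (smear c D) \<ge> 0" if r: "r \<ge> 0" for r
  proof -
    \<comment> \<open>All arguments of H needed below have absolute value at most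
      \<open>r + c\<close>; the extra 1 puts them into the interior, where the derivative is
      two-sided.\<close>
    define M where "M = r + c + 1"
    have "continuous_on {-M..M} G"
      using G(1) continuous_on_subset by blast
    then obtain H where H: "\<And>x. x \<in> {-M..M} \<Longrightarrow> (H has_vector_derivative G x) (at x within {-M..M})"
      using antiderivative_continuous by metis
    have H': "(H has_real_derivative G x) (at x)" if "x \<in> {-M<..<M}" for x
      using H[of x] that at_within_Icc_at[of "-M" x M]
      by (auto simp: has_real_derivative_iff_has_vector_derivative)
    have Heven: "H (- x) = H x" if "0 \<le> x" "x < M" for x
    proof -
      have d: "((\<lambda>x. H x - H (- x)) has_real_derivative 0) (at y)" if y: "y \<in> {0..x}" for y
      proof -
        have "((\<lambda>x. H (- x)) has_real_derivative G (- y) * (- 1)) (at y)"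
          using y \<open>x < M\<close> by (intro DERIV_chain2[where f = H] H') (auto intro!: derivative_eq_intros)
        from DERIV_diff[OF H' this] show ?thesis using y \<open>x < M\<close> odd by simp
      qed
      have "(\<lambda>x. H x - H (- x)) x = (\<lambda>x. H x - H (- x)) 0" if "0 < x"
        by (rule DERIV_isconst2[where a = 0 and b = x])
          (use that d in \<open>auto intro!: DERIV_isCont[OF d] continuous_at_imp_continuous_on\<close>)
      then show ?thesis using that by (cases "x = 0") auto
    qed
    have mono: "H x \<le> H y" if xy: "0 \<le> x" "x \<le> y" "y < M" for x y
    proof (rule DERIV_nonneg_imp_nondecreasing[OF \<open>x \<le> y\<close>])
      fix z assume "x \<le> z" "z \<le> y"
      then show "\<exists>d. (H has_real_derivative d) (at z) \<and> 0 \<le> d"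
        using xy by (intro exI[of _ "G z"] conjI H' Gpos) auto
    qed
    have "((\<lambda>u. (G (u + c) - G (u - c)) / c) has_integral
        (H (r + c) - H (r - c)) / c - (H (0 + c) - H (0 - c)) / c) {0..r}"
    proof (rule fundamental_theorem_of_calculus[OF r])
      fix u assume "u \<in> {0..r}"
      then have "((\<lambda>u. (H (u + c) - H (u - c)) / c) has_real_derivative (G (u + c) - G (u - c)) / c) (at u)"
        using c DERIV_shift[THEN iffD1, OF H', of u c] DERIV_shift[THEN iffD1, OF H', of u "- c"]
        by (intro DERIV_cdivide DERIV_diff) (auto simp: M_def)
      then show "((\<lambda>u. (H (u + c) - H (u - c)) / c) has_vector_derivative (G (u + c) - G (u - c)) / c) (at u within {0..r})"
        by (simp add: has_real_derivative_iff_has_vector_derivative has_vector_derivative_at_within)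
    qed
    then have "integral {0..r} (smear c D) = (H (r + c) - H (r - c)) / c - (H (0 + c) - H (0 - c)) / c"
      unfolding smearG[abs_def] by (rule integral_unique)
    \<comment> \<open>Evenness of H cancels the boundary terms at 0 and allows \<open>r - c\<close>
      to be replaced by its absolute value.\<close>
    also have "\<dots> = (H (r + c) - H \<bar>r - c\<bar>) / c"
      using Heven[of c] Heven[of "c - r"] r c by (auto simp: M_def abs_if)
    finally have "integral {0..r} (smear c D) = (H (r + c) - H \<bar>r - c\<bar>) / c" .
    moreover have "H \<bar>r - c\<bar> \<le> H (r + c)"
      by (rule mono) (use r c in \<open>auto simp: M_def\<close>)
    ultimately show ?thesis using c by simp
  qed
  ultimately show ?thesis
    using locally_integrable_smear[OF D assms(2)] by (auto simp: centrally_heavy_def)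
qed

section \<open>Trapezoidal densities of sums of two uniform variables\<close>

text \<open>Up to the factor 1 / q this is the length of the overlap of [w - q, w + q] with [-p, p]:
  one interval contains the other, they overlap partially, or they are disjoint.\<close>

lemma smear_indicator:
  assumes "p > 0" "q > 0"
  shows "smear q (indicator {-p..p}) w = max 0 (min (2 * q) (min (2 * p) (p + q - \<bar>w\<bar>))) / q"
proof -
  have 1: "indicat_real {-p..p} (w + q * u) = indicator {(- p - w) / q..(p - w) / q} u" for u
    using assms by (auto simp: indicator_def field_simps)
  have 2: "{-1..1} \<inter> {(- p - w) / q..(p - w) / q} = {max (- 1) ((- p - w) / q)..min 1 ((p - w) / q)}"
    by auto
  have "smear q (indicator {-p..p}) w = integral {-1..1} (\<lambda>u. if u \<in> {(- p - w) / q..(p - w) / q} then 1 else 0)"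
    unfolding smear_def 1 by (simp add: indicator_def of_bool_def)
  also have "\<dots> = integral {max (- 1) ((- p - w) / q)..min 1 ((p - w) / q)} (\<lambda>_. 1)"
    unfolding 2[symmetric] by (subst Int_commute) (rule integral_restrict_Int)
  also have "\<dots> = max 0 (min 1 ((p - w) / q) - max (- 1) ((- p - w) / q))"
    by (auto simp: max_def)
  also have "min 1 ((p - w) / q) = min q (p - w) / q"
    using assms by (simp add: min_def field_simps)
  also have "max (- 1) ((- p - w) / q) = max (- q) (- p - w) / q"
    using assms by (simp add: max_def field_simps)
  also have "max 0 (min q (p - w) / q - max (- q) (- p - w) / q) = max 0 (min q (p - w) - max (- q) (- p - w)) / q"
    using assms by (simp add: max_def field_simps)
  also have "min q (p - w) - max (- q) (- p - w) = min (2 * q) (min (2 * p) (p + q - \<bar>w\<bar>))"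
    by linarith
  finally show ?thesis .
qed

definition trapezoid :: "real \<Rightarrow> real \<Rightarrow> real \<Rightarrow> real" where
  "trapezoid p q w = smear q (indicator {-p..p}) w / p"

lemma trapezoid_pos:
  assumes "p > 0" "q > 0"
  shows "trapezoid p q w = max 0 (min (2 * q) (min (2 * p) (p + q - \<bar>w\<bar>))) / (p * q)"
  using assms by (simp add: trapezoid_def smear_indicator mult.commute)

lemma trapezoid_zero: "trapezoid p 0 w = 2 / p * indicator {-p..p} w"
  by (simp add: trapezoid_def)

lemma trapezoid_commute:
  assumes "p > 0" "q > 0"
  shows "trapezoid p q = trapezoid q p"
  using assms by (simp add: fun_eq_iff trapezoid_pos min.left_commute add.commute mult.commute)

lemma locally_integrable_indicator: "locally_integrable (indicator {a..b})"
proof -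
  have "indicat_real {a..b} integrable_on {x..y}" for x y
  proof -
    have "(\<lambda>u. if u \<in> {a..b} then 1 else (0::real)) integrable_on {x..y}"
      using integrable_restrict_Int[of "{a..b}" "\<lambda>u. 1::real" "{x..y}"]
      by (simp add: integrable_const_ivl)
    moreover have "indicat_real {a..b} = (\<lambda>u. if u \<in> {a..b} then 1 else 0)"
      by (auto simp: indicator_def)
    ultimately show ?thesis by simp
  qed
  then show ?thesis by (simp add: locally_integrable_def)
qed

lemma locally_integrable_cmult:
  "locally_integrable g \<Longrightarrow> locally_integrable (\<lambda>x. c * g x)"
  by (simp add: locally_integrable_def integrable_on_mult_right)

lemma locally_integrable_diff:
  "locally_integrable g \<Longrightarrow> locally_integrable h \<Longrightarrow> locally_integrable (\<lambda>x. g x - h x)"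
  by (simp add: locally_integrable_def integrable_diff)

lemma locally_integrable_trapezoid: "q \<ge> 0 \<Longrightarrow> locally_integrable (trapezoid p q)"
  using locally_integrable_cmult[OF locally_integrable_smear[OF locally_integrable_indicator], of q "1 / p" "-p" p]
  by (simp add: trapezoid_def[abs_def])

lemma trapezoid_nonneg: "p \<ge> 0 \<Longrightarrow> trapezoid p q w \<ge> 0"
  by (simp add: trapezoid_def smear_nonneg)

text \<open>By symmetry this is half of the total mass 4. It is computed as a plateau of height 2 /
  p on [0, p - q] plus a linear descent on [p - q, p + q].\<close>

lemma integral_trapezoid:
  assumes "0 \<le> q" "q \<le> p" "0 < p"
  shows "integral {0..p + q} (trapezoid p q) = 2"
proof (cases "q = 0")
  case True
  have "((\<lambda>_. 2 / p) has_integral p * (2 / p)) {0..p}"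
    using has_integral_const_real[of "2 / p" 0 p] assms by simp
  then have "(trapezoid p q has_integral p * (2 / p)) {0..p}"
    by (rule has_integral_eq[rotated]) (auto simp: True trapezoid_zero)
  then show ?thesis using True assms by (auto intro: integral_unique)
next
  case False
  then have q: "q > 0" using assms by simp
  have "((\<lambda>_. 2 / p) has_integral (p - q) * (2 / p)) {0..p - q}"
    using has_integral_const_real[of "2 / p" 0 "p - q"] assms by simp
  then have 1: "(trapezoid p q has_integral (p - q) * (2 / p)) {0..p - q}"
    by (rule has_integral_eq[rotated]) (use assms q in \<open>auto simp: trapezoid_pos field_simps min_def max_def\<close>)
  have "((\<lambda>w. (p + q - w) / (p * q)) has_integral
      - ((p + q - (p + q))\<^sup>2 / (2 * p * q)) - - ((p + q - (p - q))\<^sup>2 / (2 * p * q))) {p - q..p + q}"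
    by (rule fundamental_theorem_of_calculus)
      (use q assms in \<open>auto intro!: derivative_eq_intros simp: field_simps
         simp flip: has_real_derivative_iff_has_vector_derivative\<close>)
  then have 2: "(trapezoid p q has_integral
      - ((p + q - (p + q))\<^sup>2 / (2 * p * q)) - - ((p + q - (p - q))\<^sup>2 / (2 * p * q))) {p - q..p + q}"
    by (rule has_integral_eq[rotated]) (use assms q in \<open>auto simp: trapezoid_pos min_def max_def\<close>)
  have "integral {0..p + q} (trapezoid p q) =
     (p - q) * (2 / p) + (- ((p + q - (p + q))\<^sup>2 / (2 * p * q)) - - ((p + q - (p - q))\<^sup>2 / (2 * p * q)))"
    by (intro integral_unique has_integral_combine[OF _ _ 1 2]) (use assms in auto)
  also have "\<dots> = 2"
    using q assms by (simp add: field_simps power2_eq_square)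
  finally show ?thesis .
qed

text \<open>Two trapezoids over the same base with the same area cross once on each side of the origin.\<close>

lemma centrally_heavy_trapezoid_diff:
  assumes "0 \<le> q" "q \<le> q'" "q' \<le> p'" "p' \<le> p" "p + q = p' + q'" "0 < p" "0 < q'"
  shows "centrally_heavy (\<lambda>w. trapezoid p' q' w - trapezoid p q w)"
proof -
  define D where "D = (\<lambda>w. trapezoid p' q' w - trapezoid p q w)"
  \<comment> \<open>The point where the descending side (p + q - x) / (p' q') of the new trapezoid
    reaches the plateau height 2 / p of the old one; the difference changes sign there.\<close>
  define x0 where "x0 = p + q - 2 * p' * q' / p"
  have int: "locally_integrable D"
    unfolding D_def using assms by (intro locally_integrable_diff locally_integrable_trapezoid) auto
  have p': "p' > 0" using assms by simp
  have T': "trapezoid p' q' x = max 0 (min (2 / p') ((p + q - x) / (p' * q')))" if "x \<ge> 0" for x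
  proof -
    have "trapezoid p' q' x = max 0 (min (2 * q') (p + q - x)) / (p' * q')"
      using assms p' that by (simp add: trapezoid_pos min_def)
    also have "\<dots> = max 0 (min (2 / p') ((p + q - x) / (p' * q')))"
      using p' assms by (simp add: max_def min_def field_simps)
    finally show ?thesis .
  qed
  have pq: "p * q \<le> p' * q'"
  proof -
    have "p' * q' - p * q = (p - p') * (p' - q)"
      using assms(5) by (simp add: algebra_simps) (metis (no_types, opaque_lifting) add.commute distrib_left mult.commute)
    moreover have "(p - p') * (p' - q) \<ge> 0" using assms by (intro mult_nonneg_nonneg) auto
    ultimately show ?thesis by simp
  qed
  have Tle: "trapezoid p q x \<le> 2 / p" if "x \<ge> 0" for x
    using assms that by (cases "q = 0") (auto simp: trapezoid_zero trapezoid_pos indicator_def field_simps min_def max_def)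
  \<comment> \<open>Both sides descend to 0 at p + q, and p q <= p' q' makes the old side the higher
    one. For q = 0 the old profile is a plateau on all of [0, p + q].\<close>
  have Tge: "trapezoid p q x \<ge> min (2 / p) ((p + q - x) / (p' * q'))" if "x \<ge> 0" "x \<le> p + q" for x
  proof (cases "q = 0")
    case True
    then show ?thesis using that by (simp add: trapezoid_zero)
  next
    case False
    then have q: "q > 0" using assms by simp
    have "trapezoid p q x = max 0 (min (2 / p) ((p + q - x) / (p * q)))"
    proof -
      have "trapezoid p q x = max 0 (min (2 * q) (p + q - x)) / (p * q)"
        using assms q that by (simp add: trapezoid_pos min_def)
      also have "\<dots> = max 0 (min (2 / p) ((p + q - x) / (p * q)))"
        using q assms by (simp add: max_def min_def field_simps)
      finally show ?thesis .
    qed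
    moreover have "(p + q - x) / (p' * q') \<le> (p + q - x) / (p * q)"
      using pq q assms that by (intro divide_left_mono) auto
    ultimately show ?thesis by linarith
  qed
  have low: "D x \<ge> 0" if "0 \<le> x" "x \<le> x0" for x
  proof -
    have "2 / p \<le> (p + q - x) / (p' * q')"
      using that p' assms by (simp add: x0_def field_simps)
    moreover have "2 / p \<le> 2 / p'"
      using p' assms by (simp add: frac_le)
    ultimately have "2 / p \<le> trapezoid p' q' x"
      using T'[OF that(1)] by simp
    then show ?thesis using Tle[OF that(1)] by (simp add: D_def)
  qed
  have high: "D x \<le> 0" if "0 \<le> x" "x0 \<le> x" "x \<le> p + q" for x
  proof -
    have "(p + q - x) / (p' * q') \<le> 2 / p"
      using that p' assms by (simp add: x0_def field_simps)
    then have "trapezoid p q x \<ge> (p + q - x) / (p' * q')"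
      using Tge[OF that(1,3)] by simp
    moreover have "(p + q - x) / (p' * q') \<ge> 0" using that p' assms by simp
    ultimately show ?thesis using T'[OF that(1)] by (simp add: D_def)
  qed
  have zero: "D x = 0" if "x > p + q" for x
    using that assms p' by (cases "q = 0") (auto simp: D_def T' trapezoid_zero trapezoid_pos field_simps max_def min_def mult_less_0_iff)
  have total: "integral {0..p + q} D = 0"
  proof -
    have "integral {0..p + q} D = integral {0..p + q} (trapezoid p' q') - integral {0..p + q} (trapezoid p q)"
      unfolding D_def using locally_integrable_trapezoid assms
      by (intro integral_diff) (auto simp: locally_integrable_def)
    then show ?thesis
      using integral_trapezoid[of q' p'] integral_trapezoid[of q p] assms p' by simp
  qed
  have Dint: "D integrable_on {a..b}" for a b using int by (simp add: locally_integrable_def)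
  \<comment> \<open>Up to \<open>x0\<close> the integrand is nonnegative. Past \<open>x0\<close> the
    remaining part up to p + q is nonpositive while the total is 0, so the integral up to r is again
    nonnegative.\<close>
  have "integral {0..r} D \<ge> 0" if r: "r \<ge> 0" for r
  proof (cases "r \<le> x0")
    case True
    then show ?thesis by (intro integral_nonneg Dint) (use low in auto)
  next
    case False
    show ?thesis
    proof (cases "r \<le> p + q")
      case True
      have "integral {r..p + q} D \<le> integral {r..p + q} (\<lambda>_. 0)"
        by (intro integral_le Dint integrable_0) (use high False r in auto)
      then show ?thesis
        using Henstock_Kurzweil_Integration.integral_combine[of 0 r "p + q" D] True r Dint total by simp
    next
      case False
      have "integral {p + q..r} D = integral {p + q..r} (\<lambda>_. 0)"
        by (rule integral_spike[of "{p + q}"]) (use zero in auto)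
      then show ?thesis
        using Henstock_Kurzweil_Integration.integral_combine[of 0 "p + q" r D] False r Dint total assms by simp
    qed
  qed
  moreover have "D 0 \<ge> 0"
  proof (rule low)
    have "2 * p' * q' \<le> p * (p + q)"
    proof -
      have "2 * p' * q' \<le> (p' + q') * p'"
        using assms p' by (simp add: algebra_simps)
      also have "\<dots> \<le> (p' + q') * p" using assms p' by (intro mult_left_mono) auto
      finally show ?thesis using assms by (simp add: mult.commute)
    qed
    then show "0 \<le> x0" using assms by (simp add: x0_def field_simps)
  qed simp
  moreover have "D (- x) = D x" for x
    using assms p' by (cases "q = 0") (auto simp: D_def trapezoid_zero trapezoid_pos indicator_def)
  ultimately show ?thesis
    using int by (simp add: centrally_heavy_def D_def)
qed

section \<open>Hyperplane sections of the cube\<close>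

interpretation lborel_product: product_sigma_finite "\<lambda>_::'i. lborel :: real measure"
  by standard

text \<open>Writing the cube as a product of indicators under a product measure allows the
  coordinates to be integrated out one at a time.\<close>

definition cube_integral :: "'i set \<Rightarrow> ('i \<Rightarrow> real) \<Rightarrow> (real \<Rightarrow> real) \<Rightarrow> ennreal" where
  "cube_integral J a g = (\<integral>\<^sup>+ t. (\<Prod>i\<in>J. indicator {-1..1} (t i)) * ennreal (g (\<Sum>i\<in>J. a i * t i))
     \<partial>(Pi\<^sub>M J (\<lambda>_. lborel)))"

lemma cube_integral_cong:
  "(\<And>i. i \<in> J \<Longrightarrow> a i = b i) \<Longrightarrow> cube_integral J a g = cube_integral J b g"
  by (simp add: cube_integral_def)

lemma cube_integral_empty: "cube_integral {} a g = ennreal (g 0)"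
  by (simp add: cube_integral_def PiM_empty nn_integral_count_space_finite)

text \<open>Fubini: integrating out coordinate \<open>i\<close> first replaces \<open>g\<close> by
  its smear. Inductions over \<open>J\<close> therefore have to keep \<open>g\<close>
  arbitrary.\<close>

lemma cube_integral_insert:
  assumes J: "finite J" "i \<notin> J" and g: "locally_integrable g" "\<And>x. g x \<ge> 0"
    and [measurable]: "g \<in> borel_measurable borel"
  shows "cube_integral (insert i J) a g = cube_integral J a (smear (a i) g)"
proof -
  let ?P = "\<lambda>t. (\<Prod>j\<in>J. indicator {-1..1::real} (t j)) :: ennreal"
  have *: "(\<Sum>j\<in>J. a j * (if j = i then y else t j)) = (\<Sum>j\<in>J. a j * t j)"
    "(\<Prod>j\<in>J. indicator {-1..1::real} (if j = i then y else t j)) = ?P t" for t y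
    using J(2) by (auto intro!: sum.cong prod.cong)
  have "cube_integral (insert i J) a g = (\<integral>\<^sup>+ t. \<integral>\<^sup>+ y. indicator {-1..1} y * ?P t *
      ennreal (g (a i * y + (\<Sum>j\<in>J. a j * t j))) \<partial>lborel \<partial>(Pi\<^sub>M J (\<lambda>_. lborel)))"
    unfolding cube_integral_def using J
    by (subst lborel_product.product_nn_integral_insert) (simp_all add: *)
  also have "\<dots> = (\<integral>\<^sup>+ t. ?P t * ennreal (smear (a i) g (\<Sum>j\<in>J. a j * t j)) \<partial>(Pi\<^sub>M J (\<lambda>_. lborel)))"
  proof (rule nn_integral_cong)
    fix t
    let ?s = "\<Sum>j\<in>J. a j * t j"
    have "(\<integral>\<^sup>+ y. indicator {-1..1} y * ?P t * ennreal (g (a i * y + ?s)) \<partial>lborel)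
       = (\<integral>\<^sup>+ y. ?P t * ennreal (indicator {-1..1} y * g (?s + a i * y)) \<partial>lborel)"
      by (intro nn_integral_cong) (auto simp: indicator_def add.commute)
    also have "\<dots> = ?P t * (\<integral>\<^sup>+ y. ennreal (indicator {-1..1} y * g (?s + a i * y)) \<partial>lborel)"
      by (rule nn_integral_cmult) measurable
    \<comment> \<open>For a nonnegative integrand the gauge integral defining \<open>smear\<close>
      agrees with the Lebesgue integral.\<close>
    also have "(\<integral>\<^sup>+ y. ennreal (indicator {-1..1} y * g (?s + a i * y)) \<partial>lborel) = ennreal (smear (a i) g ?s)"
      using nn_integral_has_integral_lebesgue[OF _ smear_has_integral[OF g(1), of ?s "a i"]] g(2)
      by simp
    finally show "(\<integral>\<^sup>+ y. indicator {-1..1} y * ?P t * ennreal (g (a i * y + ?s)) \<partial>lborel) =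
      ?P t * ennreal (smear (a i) g ?s)" .
  qed
  finally show ?thesis by (simp add: cube_integral_def)
qed

lemma borel_measurable_smear:
  assumes "locally_integrable g" "g \<in> borel_measurable borel"
  shows "smear c g \<in> borel_measurable borel"
proof -
  have *: "smear c g \<in> borel_measurable borel" if "c > 0" for c
    using continuous_smear[OF assms(1) that] by (rule borel_measurable_continuous_onI)
  consider "c = 0" | "c > 0" | "- c > 0" by linarith
  then show ?thesis
  proof cases
    case 1
    then show ?thesis using assms(2) by simp
  next
    case 2
    then show ?thesis by (rule *)
  next
    case 3
    moreover have "smear (- c) g = smear c g" by (rule ext) (rule smear_uminus)
    ultimately show ?thesis using *[of "- c"] by simp
  qed
qed

text \<open>The cube is invariant under reflecting a coordinate, which shows up as
  \<open>smear\<close> being even in its first argument.\<close>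

lemma cube_integral_abs:
  assumes "finite J" "locally_integrable g" "\<And>x. g x \<ge> 0" "g \<in> borel_measurable borel"
  shows "cube_integral J (\<lambda>i. \<bar>a i\<bar>) g = cube_integral J a g"
  using assms
proof (induction J arbitrary: g rule: finite_induct)
  case (insert i J)
  have eq: "smear \<bar>a i\<bar> g = smear (a i) g"
    using smear_uminus[of "a i" g] by (cases "a i \<ge> 0") auto
  have "cube_integral J (\<lambda>i. \<bar>a i\<bar>) (smear \<bar>a i\<bar> g) = cube_integral J a (smear \<bar>a i\<bar> g)"
    using insert.prems by (intro insert.IH locally_integrable_smear smear_nonneg borel_measurable_smear) auto
  then show ?case
    using insert.prems insert.hyps by (simp add: cube_integral_insert eq)
qed (simp add: cube_integral_empty)

text \<open>Integrating out a coordinate keeps the difference centrally heavy. Once no coordinate is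
  left, only the values at 0 are compared; this is what the condition \<open>D 0 \<ge> 0\<close> in
  \<open>centrally_heavy\<close> provides.\<close>

lemma cube_integral_mono_centrally_heavy:
  assumes "finite J" "\<And>i. i \<in> J \<Longrightarrow> a i \<ge> 0" "centrally_heavy (\<lambda>x. h x - g x)"
    and "locally_integrable g" "\<And>x. g x \<ge> 0" "g \<in> borel_measurable borel"
    and "locally_integrable h" "\<And>x. h x \<ge> 0" "h \<in> borel_measurable borel"
  shows "cube_integral J a g \<le> cube_integral J a h"
  using assms
proof (induction J arbitrary: g h rule: finite_induct)
  case empty
  then show ?case by (auto simp: cube_integral_empty centrally_heavy_def intro: ennreal_leI)
next
  case (insert i J)
  have "centrally_heavy (smear (a i) (\<lambda>x. h x - g x))"
    using insert.prems by (intro centrally_heavy_smear) auto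
  moreover have "smear (a i) (\<lambda>x. h x - g x) = (\<lambda>x. smear (a i) h x - smear (a i) g x)"
    using insert.prems by (intro ext smear_diff)
  ultimately have "centrally_heavy (\<lambda>x. smear (a i) h x - smear (a i) g x)" by simp
  then have "cube_integral J a (smear (a i) g) \<le> cube_integral J a (smear (a i) h)"
    using insert.prems by (intro insert.IH locally_integrable_smear smear_nonneg borel_measurable_smear) auto
  then show ?case
    using insert.prems insert.hyps by (simp add: cube_integral_insert)
qed

lemma cube_integral_cmult:
  assumes "finite J" "g \<in> borel_measurable borel" "c \<ge> 0"
  shows "cube_integral J a (\<lambda>x. c * g x) = ennreal c * cube_integral J a g"
proof -
  have [measurable]: "g \<in> borel_measurable borel" by fact
  have "cube_integral J a (\<lambda>x. c * g x) = (\<integral>\<^sup>+ t. ennreal c * ((\<Prod>i\<in>J. indicator {-1..1} (t i)) *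
     ennreal (g (\<Sum>i\<in>J. a i * t i))) \<partial>(Pi\<^sub>M J (\<lambda>_. lborel)))"
    unfolding cube_integral_def using assms(3) by (simp add: ennreal_mult' mult.left_commute)
  then show ?thesis
    unfolding cube_integral_def by (simp add: nn_integral_cmult)
qed

section \<open>Equalising the weights of a sum of uniform variables\<close>

lemma borel_measurable_trapezoid: "q \<ge> 0 \<Longrightarrow> trapezoid p q \<in> borel_measurable borel"
  unfolding trapezoid_def[abs_def]
  using borel_measurable_smear[OF locally_integrable_indicator, of "-p" p q] by measurable

text \<open>Up to the factor \<open>2 ^ card I\<close>, this is the density at \<open>0\<close> of \<open>\<Sum>i\<in>I. a i * U i\<close> with
  independent \<open>U i\<close> uniform on \<open>[-1, 1]\<close>; it does not depend on the choice of \<open>k\<close> with \<open>a k > 0\<close>.\<close>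

definition section_density :: "'i set \<Rightarrow> 'i \<Rightarrow> ('i \<Rightarrow> real) \<Rightarrow> ennreal" where
  "section_density I k a = ennreal (1 / a k) * cube_integral (I - {k}) a (indicator {- a k..a k})"

lemma section_density_cong:
  "k \<in> I \<Longrightarrow> (\<And>i. i \<in> I \<Longrightarrow> a i = b i) \<Longrightarrow> section_density I k a = section_density I k b"
  using cube_integral_cong[of "I - {k}" a b] by (simp add: section_density_def)

text \<open>Coordinates \<open>k\<close> and \<open>i\<close> are merged into one trapezoid. Its
  symmetry in two positive weights makes the choice of \<open>k\<close> immaterial, and changing its
  shape changes just these two weights.\<close>

lemma section_density_trapezoid:
  assumes "finite I" "k \<in> I" "i \<in> I" "i \<noteq> k" "a k > 0" "a i \<ge> 0"
  shows "section_density I k a = cube_integral (I - {k, i}) a (trapezoid (a k) (a i))"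
proof -
  have I: "I - {k} = insert i (I - {k, i})" using assms by auto
  have m: "smear (a i) (indicator {- a k..a k}) \<in> borel_measurable borel"
    by (intro borel_measurable_smear locally_integrable_indicator) simp
  have "cube_integral (I - {k}) a (indicator {- a k..a k}) =
      cube_integral (I - {k, i}) a (smear (a i) (indicator {- a k..a k}))"
    unfolding I using assms by (intro cube_integral_insert locally_integrable_indicator) auto
  moreover have "trapezoid (a k) (a i) = (\<lambda>w. 1 / a k * smear (a i) (indicator {- a k..a k}) w)"
    by (simp add: trapezoid_def fun_eq_iff)
  ultimately show ?thesis
    using assms m by (simp add: section_density_def cube_integral_cmult del: times_divide_eq_left)
qed

lemma section_density_swap:
  assumes "finite I" "k \<in> I" "i \<in> I" "a k > 0" "a i > 0"
  shows "section_density I k a = section_density I i a"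
proof (cases "i = k")
  case False
  then show ?thesis
    using assms trapezoid_commute[of "a k" "a i"]
    by (simp add: section_density_trapezoid insert_commute)
qed simp

text \<open>The new trapezoid is more peaked than the old one, and the remaining coordinates
  preserve the comparison. Either of \<open>b i\<close>, \<open>b k\<close> may be the larger,
  because a move that fixes one of them at the mean can carry the other past it.\<close>

lemma section_density_smooth:
  assumes "finite I" "k \<in> I" "i \<in> I" "i \<noteq> k" "\<And>j. j \<in> I \<Longrightarrow> a j \<ge> 0"
    and "a i \<le> b i" "b i \<le> a k" "a i \<le> b k" "b k \<le> a k" "b i + b k = a i + a k" "0 < b i" "0 < b k"
    and "\<And>j. j \<in> I - {i, k} \<Longrightarrow> b j = a j"
  shows "section_density I k a \<le> section_density I k b"
proof -
  have ak: "a k > 0" using assms by simp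
  have ch: "centrally_heavy (\<lambda>w. trapezoid (b k) (b i) w - trapezoid (a k) (a i) w)"
  proof (cases "b i \<le> b k")
    case True
    then show ?thesis using assms ak by (intro centrally_heavy_trapezoid_diff) auto
  next
    case False
    then have "centrally_heavy (\<lambda>w. trapezoid (b i) (b k) w - trapezoid (a k) (a i) w)"
      using assms ak by (intro centrally_heavy_trapezoid_diff) auto
    then show ?thesis using trapezoid_commute[of "b i" "b k"] assms by simp
  qed
  have "section_density I k a = cube_integral (I - {k, i}) a (trapezoid (a k) (a i))"
    using assms ak by (intro section_density_trapezoid) auto
  also have "\<dots> \<le> cube_integral (I - {k, i}) a (trapezoid (b k) (b i))"
    using assms ak ch
    by (intro cube_integral_mono_centrally_heavy locally_integrable_trapezoid trapezoid_nonneg borel_measurable_trapezoid) auto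
  also have "\<dots> = cube_integral (I - {k, i}) b (trapezoid (b k) (b i))"
    using assms by (intro cube_integral_cong) auto
  also have "\<dots> = section_density I k b"
    using assms by (intro section_density_trapezoid[symmetric]) auto
  finally show ?thesis .
qed

text \<open>Induction on the number of weights that differ from the mean \<open>m\<close>: each move
  takes one weight below and one above the mean and sets the lower one to \<open>m\<close>.\<close>

lemma section_density_le_const:
  assumes "finite I" "k \<in> I" "a k > 0" "\<And>i. i \<in> I \<Longrightarrow> a i \<ge> 0" "sum a I = real (card I) * m"
  shows "section_density I k a \<le> section_density I k (\<lambda>_. m)"
  using assms(2-)
proof (induction "card {i \<in> I. a i \<noteq> m}" arbitrary: a k rule: less_induct)
  case less
  have m: "m > 0"
  proof -
    have "sum a I > 0" using less.prems assms(1) by (intro sum_pos2[of I k]) auto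
    then show ?thesis using less.prems by (simp add: zero_less_mult_iff)
  qed
  show ?case
  proof (cases "\<forall>i\<in>I. a i = m")
    case True
    then show ?thesis using section_density_cong[of k I a "\<lambda>_. m"] less.prems by simp
  next
    case False
    have sum0: "(\<Sum>i\<in>I. a i - m) = 0" using less.prems by (simp add: sum_subtractf)
    have "\<exists>i\<in>I. a i < m"
    proof (rule ccontr)
      assume "\<not> ?thesis"
      then have "\<And>i. i \<in> I \<Longrightarrow> a i - m \<ge> 0" by force
      then show False using False sum0 sum_nonneg_eq_0_iff[OF assms(1), of "\<lambda>i. a i - m"] by auto
    qed
    then obtain i where i: "i \<in> I" "a i < m" by auto
    have "\<exists>j\<in>I. a j > m"
    proof (rule ccontr)
      assume "\<not> ?thesis"
      then have "\<And>i. i \<in> I \<Longrightarrow> m - a i \<ge> 0" by force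
      moreover have "(\<Sum>i\<in>I. m - a i) = 0" using less.prems by (simp add: sum_subtractf)
      ultimately show False using False sum_nonneg_eq_0_iff[OF assms(1), of "\<lambda>i. m - a i"] by auto
    qed
    then obtain j where j: "j \<in> I" "a j > m" by auto
    have ij: "i \<noteq> j" using i j by auto
    have ai: "a i \<ge> 0" using less.prems i by auto
    \<comment> \<open>Coordinate \<open>i\<close> leaves the set of weights different from
      \<open>m\<close>. Coordinate \<open>j\<close> absorbs the change and stays positive because
      \<open>a j > m\<close> and \<open>a i \<ge> 0\<close>.\<close>
    define b where "b = a(i := m, j := a i + a j - m)"
    have b: "b i = m" "b j = a i + a j - m" "\<And>l. l \<noteq> i \<Longrightarrow> l \<noteq> j \<Longrightarrow> b l = a l"
      using ij by (auto simp: b_def)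
    have "{l \<in> I. b l \<noteq> m} \<subseteq> {l \<in> I. a l \<noteq> m} - {i}"
      using j b by (auto simp: b_def split: if_splits)
    moreover have "i \<in> {l \<in> I. a l \<noteq> m}" using i by simp
    ultimately have "{l \<in> I. b l \<noteq> m} \<subset> {l \<in> I. a l \<noteq> m}" by blast
    then have card: "card {l \<in> I. b l \<noteq> m} < card {l \<in> I. a l \<noteq> m}"
      using assms(1) by (intro psubset_card_mono) auto
    have sumb: "sum b I = sum a I"
    proof -
      have split: "sum f I = f i + f j + sum f (I - {i} - {j})" for f :: "'a \<Rightarrow> real"
        using assms(1) i j ij sum.remove[of I i f] sum.remove[of "I - {i}" j f] by simp
      have "sum b (I - {i} - {j}) = sum a (I - {i} - {j})"
        by (intro sum.cong) (auto simp: b_def)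
      then show ?thesis using split[of a] split[of b] b(1,2) by simp
    qed
    have bpos: "0 < b i" "0 < b j" using i j m ai b(1,2) by linarith+
    have bnn: "0 \<le> b l" if "l \<in> I" for l
      using bpos b(3)[of l] less.prems(3)[OF that] by (cases "l = i \<or> l = j") auto
    \<comment> \<open>The reference coordinate becomes \<open>j\<close>, since the smoothing move
      requires it to carry the larger of the two weights.\<close>
    have "section_density I k a = section_density I j a"
      using less.prems i j m assms(1) by (intro section_density_swap) auto
    also have "\<dots> \<le> section_density I j b"
    proof (rule section_density_smooth[where i = i])
      show "0 < b i" "0 < b j" by (fact bpos)+
    qed (use less.prems i j ij b assms(1) in auto)
    also have "\<dots> \<le> section_density I j (\<lambda>_. m)"
      using less.prems(4) j(1) bpos(2) bnn sumb
      by (intro less.hyps[OF card]) auto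
    also have "\<dots> = section_density I k (\<lambda>_. m)"
      using less.prems j m assms(1) by (intro section_density_swap) auto
    finally show ?thesis .
  qed
qed

section \<open>Volume of the cube cut by a central slab\<close>

text \<open>This is \<open>sym_polar\<close> of a simplex in the coordinates given by inner products
  with all vertices but one: these vertices give the cube, the remaining one the slab.\<close>

definition cube_slab :: "'a::euclidean_space \<Rightarrow> 'a set" where
  "cube_slab c = {t. (\<forall>b\<in>Basis. \<bar>t \<bullet> b\<bar> \<le> 1) \<and> \<bar>c \<bullet> t\<bar> \<le> 1}"

lemma abs_le_one_iff: "\<bar>x\<bar> \<le> 1 \<longleftrightarrow> - 1 \<le> x \<and> x \<le> 1" for x :: real
  by auto

lemma compact_cube_slab: "compact (cube_slab (c::'a::euclidean_space))"
proof -
  have "cube_slab c = cbox (- One) One \<inter> {t. c \<bullet> t \<le> 1} \<inter> {t. c \<bullet> t \<ge> - 1}"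
    by (auto simp: cube_slab_def mem_box abs_le_one_iff)
  moreover have "closed {t. c \<bullet> t \<le> 1}" "closed {t. c \<bullet> t \<ge> - 1}"
    by (intro closed_Collect_le continuous_intros)+
  ultimately show ?thesis
    by (simp add: compact_Int_closed)
qed

lemma mem_cube_slab_sum:
  fixes c :: "'a::euclidean_space"
  shows "(\<Sum>b\<in>Basis. t b *\<^sub>R b) \<in> cube_slab c \<longleftrightarrow>
      (\<forall>b\<in>Basis. t b \<in> {-1..1}) \<and> (\<Sum>b\<in>Basis. (c \<bullet> b) * t b) \<in> {-1..1}"
proof -
  have ci: "c \<bullet> (\<Sum>b\<in>Basis. t b *\<^sub>R b) = (\<Sum>b\<in>Basis. (c \<bullet> b) * t b)"
    by (simp add: inner_sum_right mult.commute)
  have "(\<forall>b\<in>Basis. \<bar>(\<Sum>b\<in>Basis. t b *\<^sub>R b) \<bullet> b\<bar> \<le> 1) \<longleftrightarrow> (\<forall>b\<in>Basis. t b \<in> {-1..1})"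
    by (rule ball_cong) (simp_all add: abs_le_one_iff)
  then show ?thesis
    by (simp only: cube_slab_def mem_Collect_eq ci atLeastAtMost_iff abs_le_one_iff)
qed

lemma emeasure_cube_slab:
  fixes c :: "'a::euclidean_space"
  shows "emeasure lborel (cube_slab c) = cube_integral Basis (\<lambda>b. c \<bullet> b) (indicator {-1..1})"
proof -
  have [measurable]: "cube_slab c \<in> sets borel"
    using compact_cube_slab by (rule borel_compact)
  have "indicator (cube_slab c) (\<Sum>b\<in>Basis. t b *\<^sub>R b) =
    (\<Prod>i\<in>Basis. indicator {-1..1} (t i)) * ennreal (indicator {-1..1} (\<Sum>b\<in>Basis. (c \<bullet> b) * t b))" for t
  proof (cases "\<forall>b\<in>Basis. t b \<in> {-1..1}")
    case True
    then have "(\<Prod>i\<in>Basis. indicator {-1..1} (t i)) = (1::ennreal)"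
      by (intro prod.neutral) simp
    then show ?thesis
      using mem_cube_slab_sum[of t c] True by (cases "(\<Sum>b\<in>Basis. t b *\<^sub>R b) \<in> cube_slab c") (simp_all del: atLeastAtMost_iff)
  next
    case False
    then have "\<exists>b\<in>Basis. indicator {-1..1} (t b) = (0::ennreal)"
      by (metis indicator_simps(2))
    then have "(\<Prod>i\<in>Basis. indicator {-1..1} (t i)) = (0::ennreal)"
      by (intro prod_zero) simp_all
    then show ?thesis
      using mem_cube_slab_sum[of t c] False by (simp del: atLeastAtMost_iff)
  qed
  note eq = this
  have "emeasure lborel (cube_slab c) = (\<integral>\<^sup>+ x. indicator (cube_slab c) x \<partial>(lborel :: 'a measure))"
    by simp
  also have "\<dots> = (\<integral>\<^sup>+ t. indicator (cube_slab c) (\<Sum>b\<in>Basis. t b *\<^sub>R b) \<partial>(Pi\<^sub>M Basis (\<lambda>_. lborel)))"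
    by (subst lborel_eq, subst nn_integral_distr) measurable
  also have "\<dots> = cube_integral Basis (\<lambda>b. c \<bullet> b) (indicator {-1..1})"
    unfolding cube_integral_def eq ..
  finally show ?thesis .
qed

text \<open>The slab acts as one more coordinate of weight 1, so the volume is a section density
  with weights 1 and the absolute values of the entries of \<open>c\<close>. Making the weights
  equal gives the bound; the factor in front is the sum of the weights.\<close>

lemma cube_slab_bound:
  fixes c :: "'a::euclidean_space"
  shows "ennreal (1 + (\<Sum>b\<in>Basis. \<bar>c \<bullet> b\<bar>)) * emeasure lborel (cube_slab c) \<le>
    ennreal (1 + real DIM('a)) * emeasure lborel (cube_slab (One :: 'a))"
proof -
  \<comment> \<open>The zero vector is not in \<open>Basis\<close> and serves as the label of the
    extra coordinate.\<close>
  define I where "I = insert (0::'a) Basis"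
  define a where "a = (\<lambda>i::'a. if i = 0 then 1 else \<bar>c \<bullet> i\<bar>)"
  define s where "s = 1 + (\<Sum>b\<in>Basis. \<bar>c \<bullet> b\<bar>)"
  define m where "m = s / (1 + real DIM('a))"
  have s: "s > 0" unfolding s_def by (intro add_pos_nonneg sum_nonneg) auto
  then have m: "m > 0" by (simp add: m_def)
  have I: "finite I" "I - {0} = Basis" "card I = Suc DIM('a)"
    by (auto simp: I_def)
  have "section_density I 0 a \<le> section_density I 0 (\<lambda>_. m)"
  proof (rule section_density_le_const)
    have "sum a I = s" by (auto simp: I_def a_def s_def intro!: sum.cong)
    then show "sum a I = real (card I) * m" using I by (simp add: m_def)
  qed (auto simp: I a_def I_def)
  moreover have "section_density I 0 a = emeasure lborel (cube_slab c)"
  proof -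
    have "section_density I 0 a = cube_integral Basis a (indicator {-1..1})"
      by (simp add: section_density_def I a_def)
    also have "\<dots> = cube_integral Basis (\<lambda>b. \<bar>c \<bullet> b\<bar>) (indicator {-1..1})"
      by (rule cube_integral_cong) (auto simp: a_def)
    also have "\<dots> = cube_integral Basis (\<lambda>b. c \<bullet> b) (indicator {-1..1})"
      by (intro cube_integral_abs locally_integrable_indicator) auto
    finally show ?thesis by (simp add: emeasure_cube_slab)
  qed
  \<comment> \<open>The section density is homogeneous of degree -1 in its weights.\<close>
  moreover have "section_density I 0 (\<lambda>_. m) = ennreal (1 / m) * emeasure lborel (cube_slab (One :: 'a))"
  proof -
    have "indicat_real {-m..m} (\<Sum>i\<in>Basis. m * t i) = indicator {-1..1} (\<Sum>i\<in>Basis. (One \<bullet> i) * t i)"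
      for t :: "'a \<Rightarrow> real"
    proof -
      have "\<bar>m * (\<Sum>i\<in>Basis. t i)\<bar> \<le> m \<longleftrightarrow> \<bar>\<Sum>i\<in>Basis. t i\<bar> \<le> 1"
        using m by (simp add: abs_mult)
      then have "m * (\<Sum>i\<in>Basis. t i) \<in> {-m..m} \<longleftrightarrow> (\<Sum>i\<in>Basis. t i) \<in> {-1..1}"
        unfolding atLeastAtMost_iff by linarith
      moreover have "(\<Sum>i\<in>Basis. (One \<bullet> i) * t i) = (\<Sum>i\<in>Basis. t i)"
        by (rule sum.cong) auto
      ultimately show ?thesis
        by (simp add: sum_distrib_left[symmetric] indicator_def)
    qed
    then have "cube_integral Basis (\<lambda>_::'a. m) (indicator {-m..m}) =
        cube_integral Basis (\<lambda>b::'a. One \<bullet> b) (indicator {-1..1})"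
      unfolding cube_integral_def by (simp only:)
    then show ?thesis by (simp add: section_density_def I emeasure_cube_slab)
  qed
  ultimately have "emeasure lborel (cube_slab c) \<le> ennreal (1 / m) * emeasure lborel (cube_slab (One :: 'a))"
    by simp
  then have "ennreal s * emeasure lborel (cube_slab c) \<le>
      ennreal s * (ennreal (1 / m) * emeasure lborel (cube_slab (One :: 'a)))"
    by (rule mult_left_mono) simp
  also have "\<dots> = ennreal (s * (1 / m)) * emeasure lborel (cube_slab (One :: 'a))"
    using s m by (subst ennreal_mult) (auto simp: mult.assoc)
  also have "s * (1 / m) = 1 + real DIM('a)"
    using s by (simp add: m_def)
  finally show ?thesis by (simp add: s_def)
qed

section \<open>The volume product of a simplex\<close>

text \<open>The matrix R is the identity plus c times a row of ones. The columns of A sum to the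
  k-th unit vector, so R A is A with c added to column k only, and Cramer's rule applies.\<close>

lemma det_one_plus_column:
  fixes c :: "real^'n"
  shows "det (\<chi> i j. (if i = j then 1 else 0) + c $ i :: real^'n^'n) = 1 + (\<Sum>i\<in>UNIV. c $ i)"
proof -
  define k :: 'n where "k = undefined"
  define R where "R = (\<chi> i j. (if i = j then 1 else 0) + c $ i :: real^'n^'n)"
  define A where "A = (\<chi> i j. if i = k then (if j = k then 1 else - 1) else if i = j then 1 else 0 :: real^'n^'n)"
  \<comment> \<open>The solution of A x = (column k of A) + c, the right-hand side being column k of
    R A.\<close>
  define x where "x = (\<chi> j. if j = k then 1 + (\<Sum>i\<in>UNIV. c $ i) else c $ j)"
  have detA: "det A = 1"
  proof -
    define y :: "real^'n" where "y = (\<chi> j. if j = k then 1 else - 1)"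
    \<comment> \<open>A is the identity with row k replaced by a combination of rows, so the
      transposed Cramer rule gives its determinant as the coefficient \<open>y $ k\<close>.\<close>
    have "A = (\<chi> i. if i = k then \<Sum>i\<in>UNIV. y $ i *s row i (mat 1) else row i (mat 1))"
      by (simp add: A_def vec_eq_iff row_def mat_def y_def if_distrib[of "(*) _"] sum.delta cong: if_cong)
    then show ?thesis
      using cramer_lemma_transpose[of k y "mat 1"] by (simp add: y_def)
  qed
  have "R ** A = (\<chi> i j. if j = k then (A *v x) $ i else A $ i $ j)"
  proof -
    have "(R ** A) $ i $ j = (if j = k then (A *v x) $ i else A $ i $ j)" for i j
    proof -
      have colsum: "(\<Sum>l\<in>UNIV. A $ l $ j) = (if j = k then 1 else 0)"
      proof -
        have "(\<Sum>l\<in>UNIV. A $ l $ j) = A $ k $ j + (\<Sum>l\<in>UNIV - {k}. A $ l $ j)"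
          by (rule sum.remove) auto
        also have "(\<Sum>l\<in>UNIV - {k}. A $ l $ j) = (\<Sum>l\<in>UNIV - {k}. if l = j then 1 else 0)"
          by (rule sum.cong) (auto simp: A_def)
        also have "\<dots> = (if j = k then 0 else 1)"
          by (simp add: sum.delta)
        finally show ?thesis by (simp add: A_def)
      qed
      have "(R ** A) $ i $ j = (\<Sum>l\<in>UNIV. (if i = l then 1 else 0) * A $ l $ j) + c $ i * (\<Sum>l\<in>UNIV. A $ l $ j)"
        by (simp add: R_def matrix_matrix_mult_def distrib_right sum.distrib sum_distrib_left)
      also have "(\<Sum>l\<in>UNIV. (if i = l then 1 else 0) * A $ l $ j) = A $ i $ j"
        by (simp add: if_distrib[of "\<lambda>u. u * _"] sum.delta cong: if_cong)
      finally have RA: "(R ** A) $ i $ j = A $ i $ j + c $ i * (if j = k then 1 else 0)"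
        by (simp add: colsum)
      have "(A *v x) $ i = A $ i $ k + c $ i"
      proof (cases "i = k")
        case True
        have "(A *v x) $ i = x $ k + (\<Sum>l\<in>UNIV - {k}. A $ k $ l * x $ l)"
          using True by (simp add: matrix_vector_mult_def sum.remove[of UNIV k] A_def)
        also have "(\<Sum>l\<in>UNIV - {k}. A $ k $ l * x $ l) = - (\<Sum>l\<in>UNIV - {k}. c $ l)"
          unfolding sum_negf[symmetric] by (rule sum.cong) (auto simp: A_def x_def)
        also have "x $ k = 1 + c $ k + (\<Sum>l\<in>UNIV - {k}. c $ l)"
          by (simp add: x_def sum.remove[of UNIV k])
        finally show ?thesis using True by (simp add: A_def)
      next
        case False
        have "(A *v x) $ i = (\<Sum>l\<in>UNIV. if i = l then x $ l else 0)"
          using False by (simp add: matrix_vector_mult_def A_def if_distrib[of "\<lambda>u. u * _"] cong: if_cong)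
        then show ?thesis using False by (simp add: A_def x_def)
      qed
      then show ?thesis using RA by simp
    qed
    then show ?thesis by (simp add: vec_eq_iff)
  qed
  then have "det (R ** A) = x $ k * det A"
    by (simp add: cramer_lemma)
  then show ?thesis
    by (simp add: det_mul detA x_def R_def)
qed

definition sym_polar :: "'a::real_inner set \<Rightarrow> 'a set" where
  "sym_polar E = {y. \<forall>v\<in>E. \<bar>v \<bullet> y\<bar> \<le> 1}"

text \<open>Let P have the columns \<open>f j\<close>. Its transpose maps \<open>sym_polar E\<close>
  onto \<open>cube_slab c\<close>, while the edge matrix of the simplex at \<open>v\<close> is P
  times the identity plus c times a row of ones. The determinant of P cancels in the
  product.\<close>

lemma simplex_volume_product:
  fixes E :: "(real^'n::{finite,wellorder}) set" and f :: "'n \<Rightarrow> real^'n::_" and c :: "real^'n::_"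
  assumes E: "finite E" "card E = Suc CARD('n)" "v \<in> E" "bij_betw f UNIV (E - {v})"
    and v: "v = - (\<Sum>j\<in>UNIV. c $ j *\<^sub>R f j)"
    and nz: "measure lborel (convex hull E) \<noteq> 0"
  shows "measure lborel (convex hull E) * measure lebesgue (sym_polar E) =
      \<bar>1 + (\<Sum>j\<in>UNIV. c $ j)\<bar> / fact CARD('n) * measure lborel (cube_slab c)"
    and "sym_polar E \<in> lmeasurable"
proof -
  define P where "P = (\<chi> i j. f j $ i)"
  define M where "M = (\<chi> i. \<chi> j. f j $ i - v $ i)"
  have "M = P ** (\<chi> i j. (if i = j then 1 else 0) + c $ i)"
    by (simp add: M_def P_def v vec_eq_iff matrix_matrix_mult_def distrib_left sum.distrib
        if_distrib[of "(*) _"] mult.commute cong: if_cong)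
  then have detM: "det M = det P * (1 + (\<Sum>j\<in>UNIV. c $ j))"
    by (simp add: det_mul det_one_plus_column)
  have content: "measure lborel (convex hull E) = \<bar>det M\<bar> / fact CARD('n)"
    unfolding M_def by (rule content_simplex[OF E])
  then have detP: "det P \<noteq> 0" using nz detM by auto
  define A where "A = transpose P"
  have detA: "det A = det P" by (simp add: A_def det_transpose)
  have "invertible A" using detA detP by (simp add: invertible_det_nz)
  then obtain A' where A': "A ** A' = mat 1" "A' ** A = mat 1"
    by (auto simp: invertible_def)
  have Ay: "(A *v y) $ j = f j \<bullet> y" for y j
    by (simp add: A_def P_def matrix_vector_mult_def transpose_def inner_vec_def)
  have E': "E = insert v (range f)"
    using E by (auto simp: bij_betw_def)
  have iff: "y \<in> sym_polar E \<longleftrightarrow> A *v y \<in> cube_slab c" for y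
  proof -
    have "c \<bullet> (A *v y) = - (v \<bullet> y)"
      by (simp add: v inner_vec_def[of c] Ay inner_sum_left)
    moreover have "(\<forall>b\<in>Basis. \<bar>(A *v y) \<bullet> b\<bar> \<le> 1) \<longleftrightarrow> (\<forall>j. \<bar>f j \<bullet> y\<bar> \<le> 1)"
      by (auto simp: Basis_vec_def inner_axis Ay)
    ultimately show ?thesis
      by (auto simp: sym_polar_def cube_slab_def E')
  qed
  have img: "sym_polar E = (\<lambda>t. A' *v t) ` cube_slab c"
  proof (intro set_eqI iffI)
    fix y assume "y \<in> sym_polar E"
    then show "y \<in> (\<lambda>t. A' *v t) ` cube_slab c"
      using iff[of y] A' by (intro image_eqI[of _ _ "A *v y"])
        (auto simp: matrix_vector_mul_assoc)
  next
    fix y assume "y \<in> (\<lambda>t. A' *v t) ` cube_slab c"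
    then obtain t where "t \<in> cube_slab c" "y = A' *v t" by blast
    then show "y \<in> sym_polar E"
      unfolding iff by (simp add: matrix_vector_mul_assoc A'(1))
  qed
  have K: "cube_slab c \<in> lmeasurable"
    using compact_cube_slab by (rule lmeasurable_compact)
  show "sym_polar E \<in> lmeasurable"
    unfolding img using K by (intro measurable_linear_image matrix_vector_mul_linear)
  have "det A' * det A = 1"
    using A'(2) by (metis det_I det_mul)
  then have "\<bar>det A'\<bar> * \<bar>det P\<bar> = 1"
    by (metis abs_1 abs_mult detA)
  moreover have "measure lebesgue (sym_polar E) = \<bar>det A'\<bar> * measure lebesgue (cube_slab c)"
    unfolding img using K by (subst measure_linear_image) (auto simp: matrix_of_matrix_vector_mul)
  moreover have "measure lebesgue (cube_slab c) = measure lborel (cube_slab c)"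
    by (rule measure_completion) (simp add: borel_compact compact_cube_slab)
  ultimately show "measure lborel (convex hull E) * measure lebesgue (sym_polar E) =
      \<bar>1 + (\<Sum>j\<in>UNIV. c $ j)\<bar> / fact CARD('n) * measure lborel (cube_slab c)"
    unfolding content detM abs_mult by (simp add: field_simps)
qed

lemma Basis_vec_eq_range_axis: "(Basis :: (real^'n) set) = range (\<lambda>i. axis i 1)"
  by (auto simp: Basis_vec_def)

lemma inj_axis_one: "inj (\<lambda>i::'n::finite. axis i (1::real))"
  by (auto simp: inj_def axis_eq_axis)

lemma sum_Basis_vec: "(\<Sum>b\<in>Basis. f (b :: real^'n)) = (\<Sum>i\<in>UNIV. f (axis i 1))"
  unfolding Basis_vec_eq_range_axis by (simp add: sum.reindex inj_axis_one)

lemma prod_Basis_vec: "(\<Prod>b\<in>Basis. f (b :: real^'n)) = (\<Prod>i\<in>UNIV. f (axis i 1))"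
  unfolding Basis_vec_eq_range_axis by (simp add: prod.reindex inj_axis_one)

lemma emeasure_compact_eq_measure:
  fixes S :: "'a::euclidean_space set"
  assumes "compact S"
  shows "emeasure lborel S = ennreal (measure lborel S)"
  using emeasure_compact_finite[OF assms] by (intro emeasure_eq_ennreal_measure) auto

text \<open>Entries of \<open>c\<close> may be negative when the origin is outside the simplex; the
  triangle inequality reduces this case to absolute values.\<close>

lemma cube_slab_bound_vec:
  fixes c :: "real^'n"
  shows "\<bar>1 + (\<Sum>j\<in>UNIV. c $ j)\<bar> * measure lborel (cube_slab c) \<le>
    (1 + real CARD('n)) * measure lborel (cube_slab (One :: real^'n))"
proof -
  have fin: "emeasure lborel (cube_slab x) = ennreal (measure lborel (cube_slab x))" for x :: "real^'n"
    by (intro emeasure_compact_eq_measure compact_cube_slab)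
  have s: "(\<Sum>b\<in>Basis. \<bar>c \<bullet> b\<bar>) = (\<Sum>j\<in>UNIV. \<bar>c $ j\<bar>)"
    by (simp add: sum_Basis_vec inner_axis)
  have "ennreal ((1 + (\<Sum>j\<in>UNIV. \<bar>c $ j\<bar>)) * measure lborel (cube_slab c)) \<le>
      ennreal ((1 + real CARD('n)) * measure lborel (cube_slab (One :: real^'n)))"
    using cube_slab_bound[of c] unfolding fin s by (simp add: ennreal_mult sum_nonneg)
  then have "(1 + (\<Sum>j\<in>UNIV. \<bar>c $ j\<bar>)) * measure lborel (cube_slab c) \<le>
      (1 + real CARD('n)) * measure lborel (cube_slab (One :: real^'n))"
    by (subst (asm) ennreal_le_iff) auto
  moreover have "\<bar>1 + (\<Sum>j\<in>UNIV. c $ j)\<bar> \<le> 1 + (\<Sum>j\<in>UNIV. \<bar>c $ j\<bar>)"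
    using sum_abs[of "\<lambda>j. c $ j" UNIV] by linarith
  ultimately show ?thesis
    by (meson measure_nonneg mult_right_mono order_trans)
qed

lemma affine_hull_eq_UNIV_of_measure:
  fixes E :: "'a::euclidean_space set"
  assumes "finite E" "measure lborel (convex hull E) \<noteq> 0"
  shows "affine hull E = UNIV"
proof -
  have "compact (convex hull E)"
    using assms by (simp add: finite_imp_compact_convex_hull)
  then have "measure lebesgue (convex hull E) \<noteq> 0"
    using assms(2) by (subst measure_completion) (auto simp: borel_compact)
  then have "interior (convex hull E) \<noteq> {}"
    using negligible_convex_interior[of "convex hull E"] negligible_imp_measure0 by auto
  then show ?thesis
    using affine_hull_nonempty_interior[of "convex hull E"] by simp
qed

lemma barycentric_coordinates_of_0:
  fixes E :: "'a::euclidean_space set"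
  assumes "finite E" "measure lborel (convex hull E) \<noteq> 0"
  obtains a where "sum a E = 1" "(\<Sum>v\<in>E. a v *\<^sub>R v) = 0"
  using affine_hull_eq_UNIV_of_measure[OF assms] affine_hull_finite[OF assms(1)] by blast

text \<open>The value in \<open>simplex_volume_product\<close> when all entries of \<open>c\<close>
  are 1, that is, when the vertices sum to zero.\<close>

definition max_volume_product :: "'n::finite itself \<Rightarrow> real" where
  "max_volume_product _ = (1 + real CARD('n)) / fact CARD('n) * measure lborel (cube_slab (One :: real^'n))"

lemma volume_product_le:
  fixes E :: "(real^'n::{finite,wellorder}) set"
  assumes E: "finite E" "card E = Suc CARD('n)" and nz: "measure lborel (convex hull E) \<noteq> 0"
  shows "measure lborel (convex hull E) * measure lebesgue (sym_polar E) \<le> max_volume_product TYPE('n)"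
    and "sym_polar E \<in> lmeasurable"
    and "\<Sum>E = 0 \<Longrightarrow> measure lborel (convex hull E) * measure lebesgue (sym_polar E) = max_volume_product TYPE('n)"
proof -
  have bij: "\<exists>f. bij_betw f (UNIV :: 'n set) (E - {v})" if "v \<in> E" for v
    using E that by (intro finite_same_card_bij) auto
  obtain a where a: "sum a E = 1" "(\<Sum>v\<in>E. a v *\<^sub>R v) = 0"
    using barycentric_coordinates_of_0[OF E(1) nz] by blast
  then obtain v where v: "v \<in> E" "a v \<noteq> 0"
    by (metis sum.neutral zero_neq_one)
  obtain f where f: "bij_betw f (UNIV :: 'n set) (E - {v})"
    using bij[OF v(1)] by blast
  \<comment> \<open>The barycentric coordinates of the origin, rescaled so that the chosen vertex
    \<open>v\<close> has weight 1.\<close>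
  define c where "c = (\<chi> j. a (f j) / a v)"
  have "(\<Sum>j\<in>UNIV. a (f j) *\<^sub>R f j) = (\<Sum>x\<in>E - {v}. a x *\<^sub>R x)"
    by (rule sum.reindex_bij_betw[OF f])
  also have "\<dots> = - (a v *\<^sub>R v)"
    using a(2) E(1) v(1) by (simp add: sum.remove eq_neg_iff_add_eq_0 add.commute)
  finally have sum_f: "(\<Sum>j\<in>UNIV. a (f j) *\<^sub>R f j) = - (a v *\<^sub>R v)" .
  have "(\<Sum>j\<in>UNIV. c $ j *\<^sub>R f j) = (1 / a v) *\<^sub>R (\<Sum>j\<in>UNIV. a (f j) *\<^sub>R f j)"
    by (simp add: c_def scaleR_sum_right)
  also have "\<dots> = - v"
    using v(2) by (simp add: sum_f)
  finally have c: "v = - (\<Sum>j\<in>UNIV. c $ j *\<^sub>R f j)" by simp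
  note prod = simplex_volume_product[OF E v(1) f c nz]
  show "sym_polar E \<in> lmeasurable" by (fact prod(2))
  show "measure lborel (convex hull E) * measure lebesgue (sym_polar E) \<le> max_volume_product TYPE('n)"
    unfolding prod(1) max_volume_product_def
    using cube_slab_bound_vec[of c] by (simp add: field_simps)
  show "measure lborel (convex hull E) * measure lebesgue (sym_polar E) = max_volume_product TYPE('n)" if "\<Sum>E = 0"
  proof -
    have "(\<Sum>j\<in>UNIV. f j) = \<Sum>(E - {v})"
      by (rule sum.reindex_bij_betw[OF f])
    also have "\<dots> = - v"
      using that E(1) v(1) by (simp add: sum.remove eq_neg_iff_add_eq_0 add.commute)
    finally have "v = - (\<Sum>j\<in>UNIV. (\<chi> j. 1) $ j *\<^sub>R f j)" by simp
    from simplex_volume_product(1)[OF E v(1) f this nz]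
    have "measure lborel (convex hull E) * measure lebesgue (sym_polar E) =
      (1 + real CARD('n)) / fact CARD('n) * measure lborel (cube_slab (\<chi> j. 1 :: real^'n::_))"
      by simp
    moreover have "(\<chi> j. 1) = (One :: real^'n::_)"
      by (simp add: sum_Basis_vec vec_eq_iff axis_def)
    ultimately show ?thesis by (simp add: max_volume_product_def)
  qed
qed

section \<open>Reindexing coordinates\<close>

text \<open>The library's linear change of variables needs a well-ordered index type, which an arbitrary
  finite type \<open>'d\<close> is not; \<open>'d idx\<close> is a well-ordered copy of it.\<close>

typedef (overloaded) ('d::finite) idx = "{..<CARD('d)}"
  by (intro exI[of _ 0]) simp

instance idx :: (finite) finite
proof
  have "UNIV = (Abs_idx :: nat \<Rightarrow> 'a idx) ` {..<CARD('a)}"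
    using type_definition.univ[OF type_definition_idx[where 'd='a]] by simp
  then show "finite (UNIV :: 'a idx set)"
    by (metis finite_imageI finite_lessThan)
qed

lemma card_idx: "CARD('d::finite idx) = CARD('d)"
  using type_definition.card[OF type_definition_idx[where 'd='d]] by simp

instantiation idx :: (finite) wellorder
begin

definition less_eq_idx :: "'a idx \<Rightarrow> 'a idx \<Rightarrow> bool" where
  "less_eq_idx x y \<longleftrightarrow> Rep_idx x \<le> Rep_idx y"

definition less_idx :: "'a idx \<Rightarrow> 'a idx \<Rightarrow> bool" where
  "less_idx x y \<longleftrightarrow> Rep_idx x < Rep_idx y"

instance
proof
  fix P :: "'a idx \<Rightarrow> bool" and x
  assume step: "\<And>x. (\<And>y. y < x \<Longrightarrow> P y) \<Longrightarrow> P x"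
  show "P x"
    by (induction x rule: measure_induct_rule[of Rep_idx]) (rule step, simp add: less_idx_def)
qed (auto simp: less_eq_idx_def less_idx_def Rep_idx_inject)

end

definition reindex :: "('n \<Rightarrow> 'd) \<Rightarrow> real^'d \<Rightarrow> real^'n" where
  "reindex h x = (\<chi> i. x $ h i)"

lemma linear_reindex: "linear (reindex h)"
  by (rule linearI) (simp_all add: reindex_def vec_eq_iff)

lemma reindex_inverse:
  assumes "bij h"
  shows "reindex (inv h) (reindex h x) = x" "reindex h (reindex (inv h) y) = y"
  using assms by (simp_all add: reindex_def vec_eq_iff bij_is_surj surj_f_inv_f bij_is_inj inv_f_f)

lemma inner_reindex:
  assumes "bij h"
  shows "reindex h x \<bullet> reindex h y = x \<bullet> y"
  unfolding inner_vec_def reindex_def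
  using sum.reindex_bij_betw[OF assms, of "\<lambda>i. x $ i \<bullet> y $ i"] by simp

lemma inj_reindex: "bij h \<Longrightarrow> inj (reindex h)"
  by (metis injI reindex_inverse(1))

lemma reindex_image_eq_vimage:
  assumes "bij h"
  shows "reindex h ` S = reindex (inv h) -` S"
  using reindex_inverse[OF assms] by (auto simp: image_iff) metis

lemma measurable_reindex [measurable]: "reindex h \<in> borel_measurable borel"
  by (intro borel_measurable_continuous_onI linear_continuous_on linear_conv_bounded_linear[THEN iffD1] linear_reindex)

text \<open>Relabelling coordinates maps boxes to boxes with the same side lengths, and Lebesgue
  measure is determined by its values on boxes.\<close>

lemma distr_lborel_reindex:
  fixes h :: "'n::finite \<Rightarrow> 'd::finite"
  assumes "bij h"
  shows "distr lborel borel (reindex h) = lborel"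
proof (rule lborel_eqI[symmetric])
  fix l u :: "real^'n" assume lu: "\<And>b. b \<in> Basis \<Longrightarrow> l \<bullet> b \<le> u \<bullet> b"
  have le: "l $ i \<le> u $ i" for i
    using lu[of "axis i 1"] by (simp add: inner_axis axis_in_Basis_iff)
  have "reindex h -` box l u = box (reindex (inv h) l) (reindex (inv h) u)"
    using assms by (auto simp: mem_box_cart reindex_def bij_inv_eq_iff) (metis bij_inv_eq_iff)+
  then have "emeasure (distr lborel borel (reindex h)) (box l u) = emeasure lborel (box (reindex (inv h) l) (reindex (inv h) u))"
    by (simp add: emeasure_distr)
  also have "\<dots> = ennreal (\<Prod>b\<in>Basis. (reindex (inv h) u - reindex (inv h) l) \<bullet> b)"
    using le by (intro emeasure_lborel_box) (auto simp: Basis_vec_eq_range_axis inner_axis reindex_def)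
  also have "(\<Prod>b\<in>Basis. (reindex (inv h) u - reindex (inv h) l) \<bullet> b) = (\<Prod>k\<in>UNIV. u $ inv h k - l $ inv h k)"
    by (simp add: prod_Basis_vec inner_axis reindex_def)
  also have "\<dots> = (\<Prod>i\<in>UNIV. u $ i - l $ i)"
    by (rule prod.reindex_bij_betw) (simp add: assms bij_imp_bij_inv)
  also have "\<dots> = (\<Prod>b\<in>Basis. (u - l) \<bullet> b)"
    by (simp add: prod_Basis_vec inner_axis)
  finally show "emeasure (distr lborel borel (reindex h)) (box l u) = ennreal (\<Prod>b\<in>Basis. (u - l) \<bullet> b)" .
qed simp

lemma borel_reindex_image:
  fixes h :: "'n::finite \<Rightarrow> 'd::finite"
  assumes "bij h" "S \<in> sets borel"
  shows "reindex h ` S \<in> sets borel"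
  unfolding reindex_image_eq_vimage[OF assms(1)]
  by (rule measurable_sets_borel[OF measurable_reindex assms(2)])

lemma emeasure_reindex_image:
  fixes h :: "'n::finite \<Rightarrow> 'd::finite"
  assumes "bij h" "S \<in> sets borel"
  shows "emeasure lborel (reindex h ` S) = emeasure lborel S"
proof -
  have "emeasure lborel (reindex h ` S) = emeasure (distr lborel borel (reindex h)) (reindex h ` S)"
    by (simp add: distr_lborel_reindex assms)
  also have "\<dots> = emeasure lborel (reindex h -` reindex h ` S)"
    using borel_reindex_image[OF assms] by (simp add: emeasure_distr)
  finally show ?thesis
    using inj_reindex[OF assms(1)] by (simp add: inj_vimage_image_eq)
qed

lemma closed_sym_polar: "closed (sym_polar E)"
proof -
  have "sym_polar E = (\<Inter>v\<in>E. {y. \<bar>v \<bullet> y\<bar> \<le> 1})"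
    by (auto simp: sym_polar_def)
  then show ?thesis
    by (auto intro!: closed_INT closed_Collect_le continuous_intros)
qed

lemma sym_polar_reindex_image:
  assumes "bij h"
  shows "sym_polar (reindex h ` E) = reindex h ` sym_polar E"
proof -
  have "\<bar>reindex h v \<bullet> y\<bar> = \<bar>v \<bullet> reindex (inv h) y\<bar>" for v y
    using inner_reindex[OF assms, of v "reindex (inv h) y"] reindex_inverse(2)[OF assms] by simp
  then show ?thesis
    unfolding reindex_image_eq_vimage[OF assms, of "sym_polar E"] by (auto simp: sym_polar_def)
qed

lemma ex_bij_idx:
  obtains h :: "'d::finite idx \<Rightarrow> 'd" where "bij h"
  using finite_same_card_bij[of "UNIV :: 'd idx set" "UNIV :: 'd set"] card_idx by auto

text \<open>Transport to an arbitrary index type: \<open>reindex h\<close> is linear, preserves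
  volume and inner products, and hence commutes with \<open>convex hull\<close> and
  \<open>sym_polar\<close>.\<close>

lemma emeasure_volume_product:
  fixes E :: "(real^'d) set"
  assumes E: "finite E" "card E = Suc CARD('d)" and nz: "emeasure lborel (convex hull E) \<noteq> 0"
  shows "emeasure lborel (sym_polar E) * emeasure lborel (convex hull E) \<le> ennreal (max_volume_product TYPE('d idx))"
    and "\<Sum>E = 0 \<Longrightarrow> emeasure lborel (sym_polar E) * emeasure lborel (convex hull E) = ennreal (max_volume_product TYPE('d idx))"
proof -
  obtain h :: "'d idx \<Rightarrow> 'd" where h: "bij h" by (rule ex_bij_idx)
  define E' where "E' = reindex h ` E"
  have E': "finite E'" "card E' = Suc CARD('d idx)"
    using E inj_reindex[OF h] by (auto simp: E'_def card_idx card_image inj_on_subset)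
  have conv: "convex hull E' = reindex h ` (convex hull E)"
    by (simp add: E'_def convex_hull_linear_image linear_reindex)
  have compact: "compact (convex hull E)" "compact (convex hull E')"
    using E E' by (simp_all add: finite_imp_compact_convex_hull)
  have pol: "sym_polar E' = reindex h ` sym_polar E"
    using h by (simp add: E'_def sym_polar_reindex_image)
  have c_eq: "emeasure lborel (convex hull E) = emeasure lborel (convex hull E')"
    unfolding conv using compact by (intro emeasure_reindex_image[symmetric] h borel_compact)
  have p_eq: "emeasure lborel (sym_polar E) = emeasure lborel (sym_polar E')"
    unfolding pol by (intro emeasure_reindex_image[symmetric] h borel_closed closed_sym_polar)
  have c_meas: "emeasure lborel (convex hull E') = ennreal (measure lborel (convex hull E'))"
    using compact(2) by (rule emeasure_compact_eq_measure)
  have nz': "measure lborel (convex hull E') \<noteq> 0"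
    using nz c_eq c_meas by auto
  note vp = volume_product_le[OF E' nz']
  have "emeasure lborel (sym_polar E') = emeasure lebesgue (sym_polar E')"
    using closed_sym_polar[of E'] by (simp add: borel_closed)
  also have "\<dots> = ennreal (measure lebesgue (sym_polar E'))"
    using vp(2) by (simp add: emeasure_eq_measure2)
  finally have "emeasure lborel (sym_polar E) * emeasure lborel (convex hull E) =
      ennreal (measure lborel (convex hull E') * measure lebesgue (sym_polar E'))"
    using p_eq c_eq c_meas by (simp add: ennreal_mult mult.commute)
  note eq = this
  show "emeasure lborel (sym_polar E) * emeasure lborel (convex hull E) \<le> ennreal (max_volume_product TYPE('d idx))"
    unfolding eq using vp(1) by (rule ennreal_leI)
  assume "\<Sum>E = 0"
  have "\<Sum>E' = reindex h (\<Sum>E)"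
    using inj_reindex[OF h] linear_sum[OF linear_reindex, of h "\<lambda>x. x" E]
    by (simp add: E'_def sum.reindex inj_on_subset)
  also have "\<dots> = 0" using \<open>\<Sum>E = 0\<close> linear_0[OF linear_reindex] by simp
  finally show "emeasure lborel (sym_polar E) * emeasure lborel (convex hull E) = ennreal (max_volume_product TYPE('d idx))"
    unfolding eq using vp(3) by simp
qed

section \<open>The centroid of a simplex\<close>

text \<open>The centroid is not computed. The affine map that swaps two vertices and fixes the
  others preserves the simplex, hence fixes its centroid 0, so the two barycentric coordinates of 0
  agree.\<close>

lemma sum_vertices_eq_0_of_integral_eq_0_wellorder:
  fixes C :: "(real^'n::{finite,wellorder}) set"
  assumes dim: "CARD('n) \<ge> 2" and C: "card C = Suc CARD('n)"
    and nz: "measure lborel (convex hull C) \<noteq> 0"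
    and int: "integral (convex hull C) (\<lambda>x. x) = 0"
  shows "\<Sum>C = 0"
proof -
  define S where "S = convex hull C"
  have fin: "finite C" using C by (intro card_ge_0_finite) simp
  have "aff_dim C = int (card C) - 1"
    using aff_dim_eq_full[of C] affine_hull_eq_UNIV_of_measure[OF fin nz] C by simp
  then have indep: "\<not> affine_dependent C"
    using fin affine_independent_iff_card by blast
  have comp: "compact S" using fin by (simp add: S_def finite_imp_compact_convex_hull)
  have meas: "S \<in> lmeasurable" using comp by (rule lmeasurable_compact)
  have nz': "measure lebesgue S \<noteq> 0"
    using nz comp unfolding S_def by (subst measure_completion) (auto simp: borel_compact)
  obtain a where a: "sum a C = 1" "(\<Sum>v\<in>C. a v *\<^sub>R v) = 0"
    using barycentric_coordinates_of_0[OF fin nz] by blast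
  have eq: "a u = a w" if uw: "u \<in> C" "w \<in> C" "u \<noteq> w" for u w
  proof -
    have "card {u, w} < card C" using dim C uw by simp
    then have "\<not> C \<subseteq> {u, w}" by (metis card_mono finite.emptyI finite_insert leD)
    \<comment> \<open>A third vertex exists since the dimension is at least 2. Being fixed by the
      swap, it serves as base point for the linear part \<open>L\<close>.\<close>
    then obtain z where z: "z \<in> C" "z \<noteq> u" "z \<noteq> w" by blast
    define \<sigma> where "\<sigma> = (\<lambda>v. if v = u then w else if v = w then u else v)"
    have "independent ((\<lambda>x. - z + x) ` (C - {z}))"
      using indep z(1) affine_dependent_iff_dependent2 by blast
    then obtain L where L: "linear L"
      and L': "\<And>x. x \<in> (\<lambda>x. - z + x) ` (C - {z}) \<Longrightarrow> L x = \<sigma> (z + x) - z"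
      using linear_independent_extend[of _ "\<lambda>x. \<sigma> (z + x) - z"] by blast
    have Lv: "L (v - z) = \<sigma> v - z" if "v \<in> C" for v
    proof (cases "v = z")
      case True
      then show ?thesis using z linear_0[OF L] by (simp add: \<sigma>_def)
    next
      case False
      then show ?thesis using L'[of "- z + v"] that by simp
    qed
    define A where "A = (\<lambda>x. (z - L z) + L x)"
    have Av: "A v = \<sigma> v" if "v \<in> C" for v
      using Lv[OF that] linear_diff[OF L, of v z] by (simp add: A_def algebra_simps)
    have "\<sigma> ` C = C"
      using uw by (auto simp: \<sigma>_def image_iff split: if_splits)
    then have AC: "A ` C = C" using Av by (metis image_cong)
    have A_img: "A ` X = (\<lambda>x. (z - L z) + x) ` (L ` X)" for X
      by (simp add: A_def image_image)
    have AS: "A ` S = S"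
    proof -
      have "A ` S = convex hull (A ` C)"
        unfolding A_img S_def by (simp add: convex_hull_linear_image[OF L] convex_hull_translation)
      then show ?thesis by (simp add: AC S_def)
    qed
    \<comment> \<open>\<open>A\<close> maps a set of positive volume onto itself, which forces
      determinant 1 or -1.\<close>
    have "measure lebesgue S = measure lebesgue (L ` S)"
      using AS A_img[of S] measure_translation[of "z - L z" "L ` S"] by simp
    also have "\<dots> = \<bar>det (matrix L)\<bar> * measure lebesgue S"
      using L meas by (rule measure_linear_image)
    finally have det: "\<bar>det (matrix L)\<bar> = 1" using nz' by simp
    then have "inj L" using det_nz_iff_inj[OF L] by auto
    then have inj: "inj_on A S" by (auto simp: A_def inj_on_def inj_def)
    have der: "(A has_derivative L) (at x within S)" for x
      unfolding A_def using linear_imp_has_derivative[OF L] by (auto intro!: derivative_eq_intros)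
    have abs: "(\<lambda>x. x) absolutely_integrable_on S"
    proof -
      obtain l where l: "S \<subseteq> cbox (- l) l"
        using comp bounded_subset_cbox_symmetric compact_imp_bounded by metis
      have "(\<lambda>x. x) absolutely_integrable_on cbox (- l) l"
        by (intro absolutely_integrable_continuous continuous_intros)
      then show ?thesis
        by (rule set_integrable_subset) (use l meas in \<open>auto simp: fmeasurableD\<close>)
    qed
    have "integral S (\<lambda>x. \<bar>det (matrix L)\<bar> *\<^sub>R A x) = 0"
      using has_absolute_integral_change_of_variables[OF _ der inj, of "\<lambda>x. x" 0] abs int meas
      by (simp add: AS S_def[symmetric] fmeasurableD)
    then have "integral S A = 0" by (simp add: det)
    \<comment> \<open>The linear part integrates to 0, so only the translation part remains and must
      vanish.\<close>
    moreover have "integral S A = measure lebesgue S *\<^sub>R (z - L z)"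
    proof -
      have id: "(\<lambda>x. x) integrable_on S" using abs by (rule set_lebesgue_integral_eq_integral(1))
      have bl: "bounded_linear L" using L by (simp add: linear_conv_bounded_linear)
      have "(\<lambda>_. z - L z) integrable_on S"
        using meas by (rule integrable_on_const)
      moreover have "L integrable_on S"
        using integrable_linear[OF id bl] by (simp add: o_def)
      ultimately have "integral S A = integral S (\<lambda>_. z - L z) + integral S L"
        unfolding A_def by (rule integral_add)
      also have "integral S L = 0"
        using integral_linear[OF id bl] int linear_0[OF L] by (simp add: o_def S_def)
      also have "integral S (\<lambda>_. z - L z) = measure lebesgue S *\<^sub>R (z - L z)"
      proof -
        have "((\<lambda>_. 1) has_integral measure lebesgue S) S"
          using meas by (simp add: lmeasure_integral lmeasurable_iff_integrable_on integrable_integral integrable_on_const)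
        then have "((\<lambda>_. 1 *\<^sub>R (z - L z)) has_integral measure lebesgue S *\<^sub>R (z - L z)) S"
          by (rule has_integral_scaleR_left)
        then show ?thesis by (simp add: integral_unique)
      qed
      finally show ?thesis by simp
    qed
    ultimately have Lz: "L z = z" using nz' by simp
    \<comment> \<open>Now \<open>L\<close> itself permutes the vertices. Applied to the barycentric
      representation of 0 it leaves (a u - a w) (w - u) = 0.\<close>
    have "(\<Sum>v\<in>C. a v *\<^sub>R (\<sigma> v - v)) = (\<Sum>v\<in>C. a v *\<^sub>R (L v - v))"
      using Lv Lz linear_diff[OF L] by (intro sum.cong) auto
    also have "\<dots> = L (\<Sum>v\<in>C. a v *\<^sub>R v) - (\<Sum>v\<in>C. a v *\<^sub>R v)"
      by (simp add: scaleR_diff_right sum_subtractf linear_sum[OF L] linear_scale[OF L])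
    also have "\<dots> = 0" using a(2) linear_0[OF L] by simp
    finally have "(\<Sum>v\<in>C. a v *\<^sub>R (\<sigma> v - v)) = 0" .
    moreover have "(\<Sum>v\<in>C. a v *\<^sub>R (\<sigma> v - v)) = (\<Sum>v\<in>{u, w}. a v *\<^sub>R (\<sigma> v - v))"
      using fin uw by (intro sum.mono_neutral_right) (auto simp: \<sigma>_def)
    moreover have "\<dots> = (a u - a w) *\<^sub>R (w - u)"
      using uw by (simp add: \<sigma>_def algebra_simps)
    ultimately show ?thesis using uw by simp
  qed
  obtain u where u: "u \<in> C" using C by fastforce
  have all: "a v = a u" if "v \<in> C" for v
    using eq[of v u] u that by (cases "v = u") auto
  have "a u *\<^sub>R \<Sum>C = (\<Sum>v\<in>C. a v *\<^sub>R v)"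
    by (simp add: scaleR_sum_right all)
  then have "a u *\<^sub>R \<Sum>C = 0" using a(2) by simp
  moreover have "a u \<noteq> 0"
  proof
    assume "a u = 0"
    then have "sum a C = 0" using all by simp
    then show False using a(1) by simp
  qed
  ultimately show ?thesis by simp
qed

text \<open>Both sides are rewritten as Bochner integrals, for which the image measure and bounded
  linear maps can be used.\<close>

lemma integral_reindex_image:
  fixes h :: "'n::finite \<Rightarrow> 'd::finite"
  assumes h: "bij h" and S: "compact S"
  shows "integral (reindex h ` S) (\<lambda>x. x) = reindex h (integral S (\<lambda>x. x))"
proof -
  have bl: "bounded_linear (reindex h)"
    using linear_reindex by (simp add: linear_conv_bounded_linear)
  have eq: "integral T (\<lambda>x. x) = (LINT x|lborel. indicator T x *\<^sub>R x)"
    and int: "integrable lborel (\<lambda>x. indicator T x *\<^sub>R x)"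
    if "compact T" for T :: "'b::euclidean_space set"
  proof -
    show int: "integrable lborel (\<lambda>x. indicator T x *\<^sub>R x)"
      using that by (intro borel_integrable_compact continuous_intros)
    then show "integral T (\<lambda>x. x) = (LINT x|lborel. indicator T x *\<^sub>R x)"
      using set_borel_integral_eq_integral(2)[of T "\<lambda>x. x"]
      by (simp add: set_integrable_def set_lebesgue_integral_def)
  qed
  have S': "compact (reindex h ` S)"
    using S linear_continuous_on[OF bl] by (intro compact_continuous_image)
  have [measurable]: "reindex h ` S \<in> sets borel" using S' by (rule borel_compact)
  have "integral (reindex h ` S) (\<lambda>x. x) = (LINT y|distr lborel borel (reindex h). indicator (reindex h ` S) y *\<^sub>R y)"
    by (simp add: eq[OF S'] distr_lborel_reindex[OF h])
  also have "\<dots> = (LINT x|lborel. indicator (reindex h ` S) (reindex h x) *\<^sub>R reindex h x)"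
    by (rule integral_distr) measurable
  also have "\<dots> = (LINT x|lborel. reindex h (indicator S x *\<^sub>R x))"
    using inj_reindex[OF h]
    by (intro Bochner_Integration.integral_cong)
       (auto simp: indicator_def inj_image_mem_iff linear_0[OF linear_reindex])
  also have "\<dots> = reindex h (LINT x|lborel. indicator S x *\<^sub>R x)"
    by (rule integral_bounded_linear[OF bl int[OF S]])
  finally show ?thesis by (simp add: eq[OF S])
qed

lemma sum_vertices_eq_0_of_integral_eq_0:
  fixes C :: "(real^'d) set"
  assumes dim: "CARD('d) \<ge> 2" and C: "card C = Suc CARD('d)"
    and nz: "emeasure lborel (convex hull C) \<noteq> 0"
    and int: "integral (convex hull C) (\<lambda>x. x) = 0"
  shows "\<Sum>C = 0"
proof -
  have fin: "finite C" using C by (intro card_ge_0_finite) simp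
  obtain h :: "'d idx \<Rightarrow> 'd" where h: "bij h" by (rule ex_bij_idx)
  define C' where "C' = reindex h ` C"
  have inj: "inj_on (reindex h) C" using inj_reindex[OF h] by (rule inj_on_subset) simp
  have comp: "compact (convex hull C)" using fin by (simp add: finite_imp_compact_convex_hull)
  have conv: "convex hull C' = reindex h ` (convex hull C)"
    by (simp add: C'_def convex_hull_linear_image linear_reindex)
  have "emeasure lborel (convex hull C') \<noteq> 0"
    unfolding conv using nz comp by (subst emeasure_reindex_image[OF h]) (auto intro: borel_compact)
  moreover have "compact (convex hull C')"
    using fin by (simp add: C'_def finite_imp_compact_convex_hull)
  then have "emeasure lborel (convex hull C') = ennreal (measure lborel (convex hull C'))"
    by (rule emeasure_compact_eq_measure)
  ultimately have "measure lborel (convex hull C') \<noteq> 0" by auto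
  moreover have "integral (convex hull C') (\<lambda>x. x) = 0"
    unfolding conv integral_reindex_image[OF h comp] int by (rule linear_0[OF linear_reindex])
  ultimately have "\<Sum>C' = 0"
    using dim C inj
    by (intro sum_vertices_eq_0_of_integral_eq_0_wellorder) (auto simp: card_idx C'_def card_image)
  moreover have "\<Sum>C' = reindex h (\<Sum>C)"
    using linear_sum[OF linear_reindex, of h "\<lambda>x. x" C] by (simp add: C'_def sum.reindex[OF inj])
  ultimately show ?thesis
    using inj_reindex[OF h] linear_0[OF linear_reindex, of h] by (metis injD)
qed

section \<open>Holmes-Thompson volume\<close>

lemma polar_subset_sym_polar:
  assumes "o_symmetric B" "E \<subseteq> B"
  shows "polar B \<subseteq> sym_polar E"
proof
  fix y assume y: "y \<in> polar B"
  have "\<bar>v \<bullet> y\<bar> \<le> 1" if "v \<in> E" for v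
  proof -
    have "v \<in> B" "- v \<in> B" using assms that by (auto simp: o_symmetric_def)
    then have "v \<bullet> y \<le> 1" "- v \<bullet> y \<le> 1" using y by (auto simp: polar_def)
    then show ?thesis by simp
  qed
  then show "y \<in> sym_polar E" by (simp add: sym_polar_def)
qed

text \<open>The constraint |x . y| <= 1 is convex and symmetric in x, so it needs checking at the
  vertices only.\<close>

lemma polar_convex_hull_symmetric:
  "polar (convex hull (convex hull C \<union> uminus ` (convex hull C))) = sym_polar C"
proof (intro subset_antisym subsetI)
  fix y assume y: "y \<in> polar (convex hull (convex hull C \<union> uminus ` (convex hull C)))"
  have "\<bar>v \<bullet> y\<bar> \<le> 1" if "v \<in> C" for v
  proof -
    have "v \<in> convex hull C" using that by (rule hull_inc)
    then have "v \<in> convex hull (convex hull C \<union> uminus ` (convex hull C))"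
      "- v \<in> convex hull (convex hull C \<union> uminus ` (convex hull C))"
      by (auto intro!: hull_inc)
    then have "v \<bullet> y \<le> 1" "- v \<bullet> y \<le> 1" using y unfolding polar_def by blast+
    then show ?thesis by simp
  qed
  then show "y \<in> sym_polar C" by (simp add: sym_polar_def)
next
  fix y assume y: "y \<in> sym_polar C"
  have convex: "convex {x. \<bar>x \<bullet> y\<bar> \<le> 1}"
  proof -
    have "{x. \<bar>x \<bullet> y\<bar> \<le> 1} = {x. y \<bullet> x \<le> 1} \<inter> {x. y \<bullet> x \<ge> - 1}"
      by (auto simp: inner_commute)
    then show ?thesis by (simp add: convex_Int convex_halfspace_le convex_halfspace_ge)
  qed
  then have "convex hull C \<subseteq> {x. \<bar>x \<bullet> y\<bar> \<le> 1}"
    using y by (intro hull_minimal) (auto simp: sym_polar_def)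
  then have "convex hull (convex hull C \<union> uminus ` (convex hull C)) \<subseteq> {x. \<bar>x \<bullet> y\<bar> \<le> 1}"
    using convex by (intro hull_minimal) auto
  then show "y \<in> polar (convex hull (convex hull C \<union> uminus ` (convex hull C)))"
    by (auto simp: polar_def)
qed

lemma vol_HT_eq:
  fixes B S :: "'a::euclidean_space set"
  shows "vol_HT B S = emeasure lebesgue (polar B) * emeasure lebesgue S / emeasure lebesgue (cball (0::'a) 1)"
  unfolding vol_HT_def by (simp add: mult.commute ennreal_times_divide)

lemma vol_HT_polytope_le:
  fixes B Q :: "(real^'d) set"
  assumes B: "o_symmetric B" and Q: "polytope Q" "Q \<subseteq> B" "card {v. v extreme_point_of Q} \<le> CARD('d) + 1"
  shows "vol_HT B Q \<le> ennreal (max_volume_product TYPE('d idx)) / emeasure lebesgue (cball (0::real^'d) 1)"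
proof -
  define E where "E = {v. v extreme_point_of Q}"
  obtain F where F: "finite F" "Q = convex hull F" using Q(1) by (auto simp: polytope_def)
  have E: "finite E"
    by (rule finite_subset[OF _ F(1)]) (auto simp: E_def F(2) dest: extreme_point_of_convex_hull)
  have QE: "Q = convex hull E"
    using Krein_Milman_polytope[OF F(1)] F(2) by (simp add: E_def)
  have "compact Q" using E QE by (simp add: finite_imp_compact_convex_hull)
  then have Qm: "emeasure lebesgue Q = emeasure lborel Q"
    by (simp add: borel_compact)
  have le: "emeasure lebesgue (polar B) * emeasure lebesgue Q \<le> ennreal (max_volume_product TYPE('d idx))"
  \<comment> \<open>If Q has volume 0, the product is 0 in \<open>ennreal\<close> even when the
    polar has infinite volume.\<close>
  proof (cases "emeasure lborel Q = 0")
    case False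
    moreover have "emeasure lborel Q = ennreal (measure lborel Q)"
      using \<open>compact Q\<close> by (rule emeasure_compact_eq_measure)
    ultimately have "affine hull E = UNIV"
      using affine_hull_eq_UNIV_of_measure[OF E] QE by auto
    then have "aff_dim E = int CARD('d)" using aff_dim_eq_full[of E] by simp
    \<comment> \<open>Spanning the whole space takes at least d + 1 points, and at most d + 1 are
      allowed.\<close>
    then have "card E = Suc CARD('d)"
      using aff_dim_le_card[OF E] Q(3) by (simp add: E_def)
    then have bound: "emeasure lborel (sym_polar E) * emeasure lborel Q \<le> ennreal (max_volume_product TYPE('d idx))"
      using emeasure_volume_product(1)[OF E] False QE by simp
    have "E \<subseteq> B" using Q(2) by (auto simp: E_def extreme_point_of_def)
    then have "emeasure lebesgue (polar B) \<le> emeasure lebesgue (sym_polar E)"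
      using polar_subset_sym_polar[OF B] closed_sym_polar[of E]
      by (intro emeasure_mono) (auto simp: borel_closed)
    also have "\<dots> = emeasure lborel (sym_polar E)"
      using closed_sym_polar[of E] by (simp add: borel_closed)
    finally have "emeasure lebesgue (polar B) * emeasure lebesgue Q \<le> emeasure lborel (sym_polar E) * emeasure lborel Q"
      unfolding Qm by (rule mult_right_mono) simp
    then show ?thesis using bound by simp
  qed (simp add: Qm)
  have "vol_HT B Q = emeasure lebesgue (polar B) * emeasure lebesgue Q / emeasure lebesgue (cball (0::real^'d) 1)"
    by (rule vol_HT_eq)
  also have "\<dots> \<le> ennreal (max_volume_product TYPE('d idx)) / emeasure lebesgue (cball (0::real^'d) 1)"
    using le by (rule divide_right_mono_ennreal)
  finally show ?thesis .
qed

theorem theorem4p5: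
  fixes S :: "(real^'d) set" and B :: "(real^'d) set"
  assumes "CARD('d) \<ge> 3"
    and "int CARD('d) simplex S"
    and "centroid S = 0"
    and "B = convex hull (S \<union> uminus ` S)"
  shows "M_HT (CARD('d) + 1) TYPE('d) = mu_HT (CARD('d) + 1) B"
proof (rule antisym)
  obtain C where C: "\<not> affine_dependent C" "card C = Suc CARD('d)" "S = convex hull C"
    using assms(2) unfolding simplex_def by auto
  have fin: "finite C" using C(1) by (rule aff_independent_finite)
  have comp: "compact S" using fin C(3) by (simp add: finite_imp_compact_convex_hull)
  have "aff_dim C = int CARD('d)" using aff_dim_affine_independent[OF C(1)] C(2) by simp
  then have "affine hull S = UNIV" using aff_dim_eq_full[of C] C(3) by simp
  then have "interior S = rel_interior S" by (simp add: rel_interior_interior)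
  moreover have "rel_interior S \<noteq> {}"
    using C fin by (subst rel_interior_eq_empty) auto
  ultimately have int: "interior S \<noteq> {}" by simp
  have mS: "emeasure lborel S = ennreal (measure lborel S)"
    using comp by (rule emeasure_compact_eq_measure)
  have "\<not> negligible S"
    using int negligible_convex_interior[of S] C(3) by simp
  then have mS': "measure lebesgue S \<noteq> 0"
    using comp negligible_iff_measure lmeasurable_compact by blast
  then have nz: "emeasure lborel (convex hull C) \<noteq> 0"
    using mS comp C(3) by (auto simp: measure_completion borel_compact)
  \<comment> \<open>The volume is nonzero, so the scalar in \<open>centroid\<close> is too, and a
    zero centroid forces a zero integral.\<close>
  have "integral (convex hull C) (\<lambda>x. x) = 0"
    using assms(3) mS' C(3) by (simp add: centroid_def)
  then have "\<Sum>C = 0"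
    using assms(1) C(2) nz by (intro sum_vertices_eq_0_of_integral_eq_0) auto
  have polarB: "polar B = sym_polar C"
    using assms(4) C(3) polar_convex_hull_symmetric by simp
  have "vol_HT B S = emeasure lebesgue (polar B) * emeasure lebesgue S / emeasure lebesgue (cball (0::real^'d) 1)"
    by (rule vol_HT_eq)
  also have "emeasure lebesgue (polar B) * emeasure lebesgue S = emeasure lborel (sym_polar C) * emeasure lborel (convex hull C)"
    using closed_sym_polar[of C] comp C(3) by (simp add: polarB borel_closed borel_compact)
  also have "\<dots> = ennreal (max_volume_product TYPE('d idx))"
    using emeasure_volume_product(2)[OF fin C(2) nz \<open>\<Sum>C = 0\<close>] .
  finally have volS: "vol_HT B S = ennreal (max_volume_product TYPE('d idx)) / emeasure lebesgue (cball (0::real^'d) 1)" .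
  \<comment> \<open>\<open>S\<close> is itself a competitor inside \<open>B\<close> and attains the
    bound that holds for every symmetric body.\<close>
  have "{v. v extreme_point_of S} \<subseteq> C"
    by (auto simp: C(3) dest: extreme_point_of_convex_hull)
  then have "card {v. v extreme_point_of S} \<le> CARD('d) + 1"
    using card_mono[OF fin] C(2) by fastforce
  moreover have "S \<subseteq> B" using assms(4) by (auto intro: hull_inc)
  moreover have "polytope S" using fin C(3) by (simp add: polytope_convex_hull)
  ultimately have volS_le: "vol_HT B S \<le> mu_HT (CARD('d) + 1) B"
    unfolding mu_HT_def by (intro SUP_upper) auto
  show "M_HT (CARD('d) + 1) TYPE('d) \<le> mu_HT (CARD('d) + 1) B"
    unfolding M_HT_def
  proof (rule SUP_least)
    fix B' :: "(real^'d) set" assume "B' \<in> {B. convex_body B \<and> o_symmetric B}"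
    then have "mu_HT (CARD('d) + 1) B' \<le> ennreal (max_volume_product TYPE('d idx)) / emeasure lebesgue (cball (0::real^'d) 1)"
      unfolding mu_HT_def by (intro SUP_least vol_HT_polytope_le) auto
    then show "mu_HT (CARD('d) + 1) B' \<le> mu_HT (CARD('d) + 1) B"
      using volS volS_le by simp
  qed
  \<comment> \<open>The other inequality only requires \<open>B\<close> to be an admissible unit
    ball.\<close>
  have "o_symmetric B"
  proof -
    have "uminus ` B = convex hull (uminus ` (S \<union> uminus ` S))"
      unfolding assms(4) by (rule convex_hull_linear_image) (simp add: linear_uminus)
    also have "uminus ` (S \<union> uminus ` S) = S \<union> uminus ` S"
      by (auto simp: image_Un image_image)
    finally show ?thesis by (simp add: o_symmetric_def assms(4))
  qed
  moreover have "convex_body B"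
  proof -
    have "compact B"
      unfolding assms(4) using comp by (intro compact_convex_hull compact_Un compact_negations)
    moreover have "interior B \<noteq> {}"
      using int interior_mono[OF \<open>S \<subseteq> B\<close>] by auto
    ultimately show ?thesis by (simp add: convex_body_def assms(4))
  qed
  ultimately show "mu_HT (CARD('d) + 1) B \<le> M_HT (CARD('d) + 1) TYPE('d)"
    unfolding M_HT_def by (intro SUP_upper) simp
qed

end
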